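(* Let $\mu, \nu \in \mathcal{M}_1(\mathbb{R}^d)$. Then the following are equivalent: (i) $\mu \preceq_{\mathrm{s}} \nu$; (ii) $\mathcal{Q}_{\mathrm{m}}(\mu,\nu) \neq \emptyset$.
   Context: $\mathcal{M}_1(\mathbb{R}^d)$ denotes the set of finite positive (i.e. nonnegative) Borel measures $\mu$ on $\mathbb{R}^d$ with finite first moment, $\int |x|\,\mu(dx)<\infty$. A function $f:\mathbb{R}^d\to\mathbb{R}$ is a support function if it is convex and positively 1-homogeneous, i.e. $f(tx)=tf(x)$ for all $x\in\mathbb{R}^d$ and $t\ge 0$. Write $\mu\preceq_{\mathrm{s}}\nu$ if $\int f\,d\mu\le\int f\,d\nu$ for every support function $f:\mathbb{R}^d\to\mathbb{R}$. An unnormalized kernel $q=(q^x)_{x\in\mathbb{R}^d}$ is a collection of finite nonnegative Borel measures on $\mathbb{R}^d$ (not necessarily probability measures) such that $x\mapsto q^x(A)$ is Borel measurable for every Borel set $A\subseteq\mathbb{R}^d$. It transports $\mu$ to $\nu$ if $\int q^x(A)\,\mu(dx)=\nu(A)$ for all Borel $A$; the set of such kernels is $\mathcal{Q}(\mu,\nu)$. A kernel $q\in\mathcal{Q}(\mu,\nu)$ is moment-preserving if $\int y\,q^x(dy)=x$ for $\mu$-a.e. $x$; the set of moment-preserving kernels in $\mathcal{Q}(\mu,\nu)$ is $\mathcal{Q}_{\mathrm{m}}(\mu,\nu)$.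
   Formalization: The formal theorem additionally assumes that μ is nonzero or ν is zero; for μ = 0 and ν = δ_0 the printed equivalence fails, since (i) holds but no kernel transports the zero measure to a nonzero one. *)

theory Defs
  imports "HOL-Analysis.Analysis"
begin

definition M1 :: "(real ^ 'n) measure set" where
  "M1 = {\<mu>. sets \<mu> = sets borel \<and> finite_measure \<mu> \<and> integrable \<mu> norm}"

definition support_function :: "(real ^ 'n \<Rightarrow> real) \<Rightarrow> bool" where
  "support_function f \<longleftrightarrow>
     convex_on UNIV f \<and> (\<forall>x. \<forall>t\<ge>0. f (t *\<^sub>R x) = t * f x)"

text \<open>Support functions are continuous and grow at most linearly, so on \<open>M1\<close> both Bochner
  integrals below are genuine integrals, not the default value 0 of non-integrable functions.\<close>

definition support_le :: "(real ^ 'n) measure \<Rightarrow> (real ^ 'n) measure \<Rightarrow> bool"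
    (infix "\<preceq>\<^sub>s" 50) where
  "\<mu> \<preceq>\<^sub>s \<nu> \<longleftrightarrow>
     (\<forall>f. support_function f \<longrightarrow> (LINT x|\<mu>. f x) \<le> (LINT x|\<nu>. f x))"

definition unnormalized_kernel :: "(real ^ 'n \<Rightarrow> (real ^ 'n) measure) \<Rightarrow> bool" where
  "unnormalized_kernel q \<longleftrightarrow>
     (\<forall>x. sets (q x) = sets borel \<and> finite_measure (q x)) \<and>
     (\<forall>A \<in> sets borel. (\<lambda>x. emeasure (q x) A) \<in> borel_measurable borel)"

definition transport_kernels ::
  "(real ^ 'n) measure \<Rightarrow> (real ^ 'n) measure \<Rightarrow> (real ^ 'n \<Rightarrow> (real ^ 'n) measure) set" where
  "transport_kernels \<mu> \<nu> =
     {q. unnormalized_kernel q \<and>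
         (\<forall>A \<in> sets borel. (\<integral>\<^sup>+ x. emeasure (q x) A \<partial>\<mu>) = emeasure \<nu> A)}"

text \<open>\<open>has_bochner_integral\<close> also demands that the identity be integrable; an equation between
  Bochner integrals alone could hold at \<open>x = 0\<close> because the integral does not exist.\<close>

definition moment_preserving_kernels ::
  "(real ^ 'n) measure \<Rightarrow> (real ^ 'n) measure \<Rightarrow> (real ^ 'n \<Rightarrow> (real ^ 'n) measure) set" where
  "moment_preserving_kernels \<mu> \<nu> =
     {q \<in> transport_kernels \<mu> \<nu>. AE x in \<mu>. has_bochner_integral (q x) (\<lambda>y. y) x}"

text \<open>The zero measure admits no kernel to a nonzero measure, but it lies below every measure
  with barycentre 0. So the equivalence of \<open>\<preceq>\<^sub>s\<close> with the existence of a
  moment-preserving kernel needs \<open>\<mu> \<noteq> 0\<close> or \<open>\<nu> = 0\<close>.\<close>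

lemma zero_measure_counterexample:
  "\<exists>\<mu> \<nu> :: (real ^ 'n) measure. \<mu> \<in> M1 \<and> \<nu> \<in> M1 \<and> \<mu> \<preceq>\<^sub>s \<nu> \<and>
     moment_preserving_kernels \<mu> \<nu> = {}"
proof -
  define \<mu> :: "(real ^ 'n) measure" where "\<mu> = null_measure borel"
  define \<nu> :: "(real ^ 'n) measure" where "\<nu> = distr (count_space {()}) borel (\<lambda>_. 0)"
  have fin: "finite_measure (count_space {()})"
    by (rule finite_measure_count_space) simp
  have L: "(LINT x|\<nu>. f x) = f 0" if "f \<in> borel_measurable borel" for f :: "real ^ 'n \<Rightarrow> real"
    unfolding \<nu>_def using that
    by (subst integral_distr) (auto simp: lebesgue_integral_count_space_finite)
  have "\<mu> \<in> M1"
    unfolding M1_def \<mu>_def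
    by (auto intro!: finite_measureI simp: integrable_iff_bounded nn_integral_null_measure)
  moreover have "\<nu> \<in> M1"
    unfolding M1_def \<nu>_def
    by (auto simp: integrable_distr_eq integrable_count_space
          intro!: finite_measure.finite_measure_distr[OF fin])
  moreover have "\<mu> \<preceq>\<^sub>s \<nu>"
    unfolding support_le_def
  proof (intro allI impI)
    fix f :: "real ^ 'n \<Rightarrow> real"
    assume f: "support_function f"
    then have "continuous_on UNIV f"
      by (auto simp: support_function_def intro: convex_on_continuous)
    then have "(LINT x|\<nu>. f x) = f 0"
      by (intro L borel_measurable_continuous_onI)
    also have "f 0 = 0"
      using f unfolding support_function_def by (metis order_refl mult_zero_left scale_zero_left)
    finally show "(LINT x|\<mu>. f x) \<le> (LINT x|\<nu>. f x)"
      unfolding \<mu>_def by (simp add: integral_eq_zero_AE AE_iff_null null_sets_def)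
  qed
  moreover have "moment_preserving_kernels \<mu> \<nu> = {}"
  proof -
    have "(\<integral>\<^sup>+ x. g x \<partial>\<mu>) \<noteq> emeasure \<nu> UNIV" for g
      unfolding \<mu>_def \<nu>_def by (simp add: emeasure_distr nn_integral_null_measure)
    then show ?thesis
      unfolding moment_preserving_kernels_def transport_kernels_def
      using sets.top[of borel] by fastforce
  qed
  ultimately show ?thesis by blast
qed

end

theory Submission
  imports Defs "HOL-Probability.Probability"
begin

text \<open>
  If a moment-preserving kernel \<open>q\<close> exists and \<open>f\<close> is a support function, then
  \<open>f x \<le> \<integral>f dq\<^sup>x\<close> by Jensen's inequality, which holds for measures of any total mass because
  \<open>f\<close> is homogeneous (\<open>support_function_Jensen\<close>). Integrating over \<open>\<mu>\<close> gives \<open>\<mu> \<preceq>\<^sub>s \<nu>\<close>.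

  For the converse, the difficulty is that the masses of the \<open>q\<^sup>x\<close> are not bounded a priori, so
  kernels from \<open>\<mu>\<close> to \<open>\<nu>\<close> do not form a compact set. The proof therefore splits \<open>\<nu>\<close> instead: it
  looks for a \<^emph>\<open>probability\<close> kernel \<open>r\<close> in the opposite direction, which distributes the mass of
  \<open>\<nu>\<close> at \<open>y\<close> over the points \<open>x\<close>, such that for all Borel sets \<open>A\<close>
  \[ \int r^y(A)\, y\, \nu(dy) = \int_A x\, \mu(dx). \]
  This is the moment condition, integrated over \<open>A\<close>, for the coupling \<open>r\<^sup>y(dx) \<nu>(dy)\<close>.

  For a finite partition of the \<open>x\<close>-space into cells \<open>A\<^sub>i\<close> one needs a partition of unity
  \<open>w\<^sub>i\<close> with \<open>\<integral>w\<^sub>i(y) y \<nu>(dy) = \<integral>\<^bsub>A\<^sub>i\<^esub> x \<mu>(dx)\<close>. The attainable moment vectors form a convex set, and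
  its support function in the direction \<open>(a\<^sub>i)\<close> is \<open>\<integral>max\<^sub>i a\<^sub>i \<bullet> y \<nu>(dy)\<close>. As
  \<open>max\<^sub>i a\<^sub>i \<bullet> y\<close> is itself a support function, \<open>\<mu> \<preceq>\<^sub>s \<nu>\<close> is exactly what puts the wanted vector
  into the closure of that set (\<open>partition_of_unity_approximating_moments\<close>). A Hilbert space
  argument, the existence of elements of minimal norm in nested closed convex sets, makes the
  conditions exact and simultaneous for countably many sets (\<open>nested_convex_Inter_nonempty\<close>,
  \<open>fractional_sets_with_prescribed_moments\<close>). A Borel coding of \<open>\<real>\<^sup>n\<close> by \<open>[0,1]\<close> turns these sets
  into half lines, so that the weights become distribution functions and define the kernel
  \<open>r\<close> (\<open>kernel_of_distribution_functions\<close>).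

  It remains to reverse \<open>r\<close>. The image of \<open>\<nu>\<close> under \<open>r\<close> need not be absolutely continuous with
  respect to \<open>\<mu>\<close>. But its singular part sits on a \<open>\<mu>\<close>-null set \<open>Z\<close>, and there the moment identity
  says that the corresponding part of \<open>\<nu>\<close> has moment zero; hence this part can be spread over all
  \<open>x\<close> proportionally to \<open>\<mu>\<close> without changing any moment
  (\<open>moment_kernel_abs_continuous\<close>). This is the place where \<open>\<mu> \<noteq> 0\<close> matters. After
  that, Radon--Nikodym densities disintegrate the coupling with respect to \<open>\<mu>\<close>
  (\<open>reverse_kernel\<close>), and uniqueness of densities turns the integrated moment condition into the
  pointwise one.
\<close>

section \<open>Support functions and Jensen's inequality\<close>

lemma M1_D:
  assumes "\<mu> \<in> M1"
  shows "sets \<mu> = sets borel" "finite_measure \<mu>" "space \<mu> = UNIV" "integrable \<mu> norm"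
    "integrable \<mu> (\<lambda>x. x)"
proof -
  show *: "sets \<mu> = sets borel" "finite_measure \<mu>" "integrable \<mu> norm"
    using assms by (auto simp: M1_def)
  show "space \<mu> = UNIV"
    using sets_eq_imp_space_eq[OF *(1)] by simp
  have "(\<lambda>x. x) \<in> borel_measurable \<mu>"
    using *(1) by (simp add: measurable_ident_sets)
  then show "integrable \<mu> (\<lambda>x. x)"
    using *(3) by (subst integrable_norm_iff[symmetric]) auto
qed

lemma support_function_measurable:
  assumes "support_function f"
  shows "f \<in> borel_measurable borel"
  using assms
  by (intro borel_measurable_continuous_onI convex_on_continuous) (auto simp: support_function_def)

lemma support_function_linear_growth:
  fixes f :: "real ^ 'n \<Rightarrow> real"
  assumes "support_function f"
  obtains C where "\<And>x. \<bar>f x\<bar> \<le> C * norm x"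
proof -
  have "continuous_on (sphere 0 1) f"
    using assms by (intro continuous_on_subset[OF convex_on_continuous[of UNIV f]]) (auto simp: support_function_def)
  then have "bounded (f ` sphere 0 1)"
    by (intro compact_imp_bounded compact_continuous_image) auto
  then obtain C where "\<forall>x\<in>sphere 0 1. \<bar>f x\<bar> \<le> C"
    by (auto simp: bounded_iff)
  then have C: "\<bar>f x\<bar> \<le> C" if "norm x = 1" for x
    using that by simp
  have hom: "f (t *\<^sub>R x) = t * f x" if "0 \<le> t" for t x
    using assms that by (auto simp: support_function_def)
  have "\<bar>f x\<bar> \<le> C * norm x" for x
  proof (cases "x = 0")
    case True
    then show ?thesis using hom[of 0 0] by simp
  next
    case False
    have "f x = norm x * f (x /\<^sub>R norm x)"
      using hom[of "norm x" "x /\<^sub>R norm x"] False by simp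
    then have "\<bar>f x\<bar> = norm x * \<bar>f (x /\<^sub>R norm x)\<bar>" by (simp add: abs_mult)
    also have "\<dots> \<le> norm x * C"
      using False by (intro mult_left_mono C) auto
    finally show ?thesis by (simp add: mult.commute)
  qed
  then show ?thesis by (rule that)
qed

lemma support_function_integrable:
  assumes "support_function f" "\<mu> \<in> M1"
  shows "integrable \<mu> f"
proof -
  obtain C where C: "\<And>x. \<bar>f x\<bar> \<le> C * norm x"
    using support_function_linear_growth[OF assms(1)] by blast
  have "integrable \<mu> (\<lambda>x. C * norm x)"
    using M1_D(4)[OF assms(2)] by simp
  moreover have "f \<in> borel_measurable \<mu>"
    using support_function_measurable[OF assms(1)] M1_D(1)[OF assms(2)]
    by (simp add: measurable_cong_sets[of \<mu> borel])
  ultimately show ?thesis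
    by (rule Bochner_Integration.integrable_bound) (use C in \<open>auto intro!: AE_I2 intro: order_trans[OF _ abs_ge_self]\<close>)
qed

lemma support_function_Max_inner:
  fixes a :: "'i \<Rightarrow> real ^ 'n"
  assumes I: "finite I" "I \<noteq> {}"
  shows "support_function (\<lambda>v. Max ((\<lambda>i. a i \<bullet> v) ` I))"
proof -
  let ?f = "\<lambda>v. Max ((\<lambda>i. a i \<bullet> v) ` I)"
  have le: "a i \<bullet> v \<le> ?f v" if "i \<in> I" for i v
    using I that by (intro Max_ge) auto
  have "convex_on UNIV ?f"
  proof (rule convex_onI)
    fix t x y assume t: "0 < t" "t < (1 :: real)"
    show "?f ((1 - t) *\<^sub>R x + t *\<^sub>R y) \<le> (1 - t) * ?f x + t * ?f y"
      using I t le by (auto simp: inner_add_right intro!: add_mono mult_left_mono)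
  qed simp
  moreover have "?f (t *\<^sub>R x) = t * ?f x" if "0 \<le> t" for t x
  proof -
    have "mono ((*) t)" using that by (intro monoI mult_left_mono)
    then have "t * ?f x = Max ((*) t ` (\<lambda>i. a i \<bullet> x) ` I)"
      using I by (intro mono_Max_commute) auto
    then show ?thesis by (simp add: image_image)
  qed
  ultimately show ?thesis by (simp add: support_function_def)
qed

text \<open>
  The epigraph of \<open>f\<close> is a closed convex cone. A hyperplane that separates a point from it may be
  taken through the origin, so it yields a linear inequality between \<open>y\<close> and \<open>f y\<close> that can be
  integrated against a measure of any total mass.
\<close>
lemma support_function_Jensen:
  fixes f :: "real ^ 'n \<Rightarrow> real"
  assumes f: "support_function f" and x: "has_bochner_integral Q (\<lambda>y. y) x"
    and s: "has_bochner_integral Q f s"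
  shows "f x \<le> s"
proof (rule ccontr)
  assume "\<not> f x \<le> s"
  define S where "S = {z :: (real ^ 'n) \<times> real. f (fst z) \<le> snd z}"
  have hom: "f (t *\<^sub>R x) = t * f x" if "0 \<le> t" for t x
    using f that by (auto simp: support_function_def)
  have f0: "f 0 = 0" using hom[of 0 0] by simp
  have cont: "continuous_on UNIV f"
    using f by (intro convex_on_continuous) (auto simp: support_function_def)
  have S: "convex S" "closed S" "(x, s) \<notin> S"
  proof -
    show "convex S"
    proof (rule convexI)
      fix z w :: "(real ^ 'n) \<times> real" and u v :: real
      assume z: "z \<in> S" and w: "w \<in> S" and uv: "0 \<le> u" "0 \<le> v" "u + v = 1"
      have "f (u *\<^sub>R fst z + v *\<^sub>R fst w) \<le> u * f (fst z) + v * f (fst w)"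
        using f uv by (auto simp: support_function_def convex_on_def)
      also have "\<dots> \<le> u * snd z + v * snd w"
        using z w uv by (intro add_mono mult_left_mono) (auto simp: S_def)
      finally show "u *\<^sub>R z + v *\<^sub>R w \<in> S" by (simp add: S_def)
    qed
    show "closed S"
      unfolding S_def
      by (intro closed_Collect_le continuous_on_compose2[OF cont] continuous_intros) auto
    show "(x, s) \<notin> S" using \<open>\<not> f x \<le> s\<close> by (simp add: S_def)
  qed
  obtain a b where sep: "inner a (x, s) < b" "\<And>z. z \<in> S \<Longrightarrow> b < inner a z"
    using separating_hyperplane_closed_point[OF S] by blast
  have b: "b < 0" using sep(2)[of 0] by (simp add: S_def f0)
  have pos: "0 \<le> inner a z" if z: "z \<in> S" for z
  proof (rule ccontr)
    assume neg: "\<not> 0 \<le> inner a z"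
    define t where "t = b / inner a z"
    have "0 \<le> t" using neg b by (auto simp: t_def divide_nonpos_neg)
    then have "t *\<^sub>R z \<in> S" using z by (auto simp: S_def hom intro: mult_left_mono)
    from sep(2)[OF this] show False using neg by (simp add: t_def)
  qed
  have "has_bochner_integral Q (\<lambda>y. inner (fst a) y + snd a * f y) (inner (fst a) x + snd a * s)"
    using x s by (intro has_bochner_integral_add has_bochner_integral_inner_right has_bochner_integral_mult_right)
  then have "inner (fst a) x + snd a * s = (LINT y|Q. inner (fst a) y + snd a * f y)"
    by (simp add: has_bochner_integral_integral_eq)
  moreover have "0 \<le> inner (fst a) y + snd a * f y" for y
    using pos[of "(y, f y)"] by (simp add: S_def inner_prod_def)
  ultimately have "0 \<le> inner (fst a) x + snd a * s" by simp
  then show False using sep(1) b by (simp add: inner_prod_def)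
qed

section \<open>Integration against kernels\<close>

text \<open>
  Measurability is only required with respect to \<open>\<mu>\<close>, and \<open>\<mu>\<close> and \<open>\<theta>\<close> are arbitrary, so that the
  notion also applies after reweighting source and target.
\<close>
definition transports :: "('a \<Rightarrow> 'b::topological_space measure) \<Rightarrow> 'a measure \<Rightarrow> 'b measure \<Rightarrow> bool" where
  "transports q \<mu> \<theta> \<longleftrightarrow> (\<forall>x. sets (q x) = sets borel) \<and> sets \<theta> = sets borel \<and>
    (\<forall>B \<in> sets borel. (\<lambda>x. emeasure (q x) B) \<in> borel_measurable \<mu> \<and>
      (\<integral>\<^sup>+x. emeasure (q x) B \<partial>\<mu>) = emeasure \<theta> B)"

lemma nn_integral_kernel:
  assumes tr: "transports q \<mu> \<theta>"
    and f: "f \<in> borel_measurable borel"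
  shows "(\<lambda>x. \<integral>\<^sup>+y. f y \<partial>q x) \<in> borel_measurable \<mu>"
    and "(\<integral>\<^sup>+x. (\<integral>\<^sup>+y. f y \<partial>q x) \<partial>\<mu>) = (\<integral>\<^sup>+y. f y \<partial>\<theta>)"
proof -
  have sets: "\<And>x. sets (q x) = sets borel" "sets \<theta> = sets borel"
    and q: "\<And>B. B \<in> sets borel \<Longrightarrow> (\<lambda>x. emeasure (q x) B) \<in> borel_measurable \<mu>"
    and q_tr: "\<And>B. B \<in> sets borel \<Longrightarrow> (\<integral>\<^sup>+x. emeasure (q x) B \<partial>\<mu>) = emeasure \<theta> B"
    using tr by (auto simp: transports_def)
  have "(\<lambda>x. \<integral>\<^sup>+y. f y \<partial>q x) \<in> borel_measurable \<mu> \<and>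
    (\<integral>\<^sup>+x. (\<integral>\<^sup>+y. f y \<partial>q x) \<partial>\<mu>) = (\<integral>\<^sup>+y. f y \<partial>\<theta>)"
    using f
  proof (induction rule: borel_measurable_induct)
    case (cong f g)
    then have "f = g" by auto
    with cong show ?case by simp
  next
    case (set A)
    then show ?case using q q_tr by (simp add: sets)
  next
    case (mult u c)
    have [simp]: "u \<in> borel_measurable (q x)" "u \<in> borel_measurable \<theta>" for x
      using mult.hyps by (simp_all add: measurable_cong_sets[OF sets(1) refl] measurable_cong_sets[OF sets(2) refl])
    show ?case using mult.IH by (auto simp: nn_integral_cmult intro!: borel_measurable_times)
  next
    case (add u v)
    have [simp]: "u \<in> borel_measurable (q x)" "u \<in> borel_measurable \<theta>"
      "v \<in> borel_measurable (q x)" "v \<in> borel_measurable \<theta>" for x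
      using add.hyps by (simp_all add: measurable_cong_sets[OF sets(1) refl] measurable_cong_sets[OF sets(2) refl])
    show ?case using add.IH by (auto simp: nn_integral_add intro!: borel_measurable_add)
  next
    case (seq U)
    have U: "U i \<in> borel_measurable (q x)" "U i \<in> borel_measurable \<theta>" for i x
      using seq.hyps by (simp_all add: measurable_cong_sets[OF sets(1) refl] measurable_cong_sets[OF sets(2) refl])
    have sup: "(SUP i. U i) = (\<lambda>y. SUP i. U i y)" by (auto simp: fun_eq_iff image_image)
    have mono: "incseq (\<lambda>i x. \<integral>\<^sup>+y. U i y \<partial>q x)"
      using \<open>incseq U\<close> by (auto simp: incseq_def le_fun_def intro!: nn_integral_mono)
    have q_sup: "(\<integral>\<^sup>+y. (SUP i. U i y) \<partial>q x) = (SUP i. \<integral>\<^sup>+y. U i y \<partial>q x)" for x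
      by (rule nn_integral_monotone_convergence_SUP[OF \<open>incseq U\<close> U(1)])
    show ?case
      unfolding sup q_sup
    proof
      show "(\<lambda>x. SUP i. \<integral>\<^sup>+y. U i y \<partial>q x) \<in> borel_measurable \<mu>"
        using seq.IH by (intro borel_measurable_SUP) auto
      have "(\<integral>\<^sup>+x. (SUP i. \<integral>\<^sup>+y. U i y \<partial>q x) \<partial>\<mu>) = (SUP i. \<integral>\<^sup>+x. (\<integral>\<^sup>+y. U i y \<partial>q x) \<partial>\<mu>)"
        using seq.IH by (intro nn_integral_monotone_convergence_SUP[OF mono]) auto
      also have "\<dots> = (\<integral>\<^sup>+y. (SUP i. U i y) \<partial>\<theta>)"
        using seq.IH nn_integral_monotone_convergence_SUP[OF \<open>incseq U\<close> U(2)] by simp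
      finally show "(\<integral>\<^sup>+x. (SUP i. \<integral>\<^sup>+y. U i y \<partial>q x) \<partial>\<mu>) = (\<integral>\<^sup>+y. (SUP i. U i y) \<partial>\<theta>)" .
    qed
  qed
  then show "(\<lambda>x. \<integral>\<^sup>+y. f y \<partial>q x) \<in> borel_measurable \<mu>"
    and "(\<integral>\<^sup>+x. (\<integral>\<^sup>+y. f y \<partial>q x) \<partial>\<mu>) = (\<integral>\<^sup>+y. f y \<partial>\<theta>)" by auto
qed

lemma integral_kernel_nonneg:
  fixes f :: "_ \<Rightarrow> real"
  assumes tr: "transports q \<mu> \<theta>"
    and f: "integrable \<theta> f" "\<And>y. 0 \<le> f y"
  shows "integrable \<mu> (\<lambda>x. LINT y|q x. f y)" "AE x in \<mu>. integrable (q x) f"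
    "(LINT x|\<mu>. (LINT y|q x. f y)) = (LINT y|\<theta>. f y)"
proof -
  have sets: "\<And>x. sets (q x) = sets borel" "sets \<theta> = sets borel"
    using tr by (auto simp: transports_def)
  have fb: "f \<in> borel_measurable borel"
    using f(1) by (simp add: measurable_cong_sets[OF sets(2) refl] borel_measurable_integrable
        flip: measurable_cong_sets[OF sets(2) refl])
  then have fm: "f \<in> borel_measurable (q x)" for x
    by (simp add: measurable_cong_sets[OF sets(1) refl])
  have fe: "(\<lambda>y. ennreal (f y)) \<in> borel_measurable borel" using fb by measurable
  note nn = nn_integral_kernel[OF tr fe]
  have f\<theta>: "(\<integral>\<^sup>+y. ennreal (f y) \<partial>\<theta>) = ennreal (LINT y|\<theta>. f y)"
    using f by (intro nn_integral_eq_integral) auto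
  have q_eq: "(LINT y|q x. f y) = enn2real (\<integral>\<^sup>+y. ennreal (f y) \<partial>q x)" for x
    using f(2) fm by (intro integral_eq_nn_integral) auto
  have fin: "AE x in \<mu>. (\<integral>\<^sup>+y. ennreal (f y) \<partial>q x) \<noteq> \<infinity>"
    by (rule nn_integral_PInf_AE[OF nn(1)]) (simp add: nn(2) f\<theta>)
  then show "AE x in \<mu>. integrable (q x) f"
    by eventually_elim (use f(2) fm in \<open>auto intro!: integrableI_nonneg simp: less_top\<close>)
  have "(\<integral>\<^sup>+x. ennreal (LINT y|q x. f y) \<partial>\<mu>) = (\<integral>\<^sup>+x. (\<integral>\<^sup>+y. ennreal (f y) \<partial>q x) \<partial>\<mu>)"
  proof (rule nn_integral_cong_AE)
    show "AE x in \<mu>. ennreal (LINT y|q x. f y) = (\<integral>\<^sup>+y. ennreal (f y) \<partial>q x)"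
      using fin by eventually_elim (simp add: q_eq less_top)
  qed
  also have "\<dots> = ennreal (LINT y|\<theta>. f y)" by (simp add: nn(2) f\<theta>)
  finally have eq: "(\<integral>\<^sup>+x. ennreal (LINT y|q x. f y) \<partial>\<mu>) = ennreal (LINT y|\<theta>. f y)" .
  have m: "(\<lambda>x. LINT y|q x. f y) \<in> borel_measurable \<mu>"
    unfolding q_eq using nn(1) by measurable
  have nonneg: "0 \<le> (LINT y|q x. f y)" for x using f(2) by simp
  show int: "integrable \<mu> (\<lambda>x. LINT y|q x. f y)"
    by (rule integrableI_nonneg[OF m]) (use nonneg in \<open>auto simp: eq\<close>)
  have "ennreal (LINT x|\<mu>. (LINT y|q x. f y)) = ennreal (LINT y|\<theta>. f y)"
    using nn_integral_eq_integral[OF int] nonneg eq by simp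
  then show "(LINT x|\<mu>. (LINT y|q x. f y)) = (LINT y|\<theta>. f y)"
    using f(2) nonneg by (subst (asm) ennreal_inj) auto
qed

text \<open>
  The integral of \<open>f\<close> against \<open>q x\<close>, split into positive and negative part. Each part is measurable in
  \<open>x\<close> without any integrability, and the difference agrees with the Bochner integral wherever \<open>f\<close> is
  integrable. The explicit formula makes the function independent of the weight put on
  the source measure.
\<close>
definition kernel_integral :: "('a \<Rightarrow> 'b measure) \<Rightarrow> ('b \<Rightarrow> real) \<Rightarrow> 'a \<Rightarrow> real" where
  "kernel_integral q f x = (LINT y|q x. max 0 (f y)) - (LINT y|q x. max 0 (- f y))"

lemma integral_kernel:
  fixes f :: "_ \<Rightarrow> real"
  assumes tr: "transports q \<mu> \<theta>"
    and f: "integrable \<theta> f"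
  shows "integrable \<mu> (kernel_integral q f)"
    "AE x in \<mu>. has_bochner_integral (q x) f (kernel_integral q f x)"
    "(LINT x|\<mu>. kernel_integral q f x) = (LINT y|\<theta>. f y)"
proof -
  have i: "integrable \<theta> (\<lambda>y. max 0 (f y))" "integrable \<theta> (\<lambda>y. max 0 (- f y))"
    using f by auto
  have split: "f y = max 0 (f y) - max 0 (- f y)" for y by simp
  note p = integral_kernel_nonneg[OF tr i(1) max.cobounded1] and n = integral_kernel_nonneg[OF tr i(2) max.cobounded1]
  show "integrable \<mu> (kernel_integral q f)"
    unfolding kernel_integral_def[abs_def] using p(1) n(1) by simp
  show "AE x in \<mu>. has_bochner_integral (q x) f (kernel_integral q f x)"
    using p(2) n(2)
  proof eventually_elim
    fix x assume "integrable (q x) (\<lambda>y. max 0 (f y))" "integrable (q x) (\<lambda>y. max 0 (- f y))"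
    then have "has_bochner_integral (q x) (\<lambda>y. max 0 (f y) - max 0 (- f y)) (kernel_integral q f x)"
      unfolding kernel_integral_def by (intro has_bochner_integral_diff has_bochner_integral_integrable)
    then show "has_bochner_integral (q x) f (kernel_integral q f x)"
      by (simp flip: split)
  qed
  have "(LINT x|\<mu>. kernel_integral q f x) = (LINT y|\<theta>. max 0 (f y)) - (LINT y|\<theta>. max 0 (- f y))"
    unfolding kernel_integral_def using p(1,3) n(1,3) by simp
  also have "\<dots> = (LINT y|\<theta>. max 0 (f y) - max 0 (- f y))"
    using i by simp
  finally show "(LINT x|\<mu>. kernel_integral q f x) = (LINT y|\<theta>. f y)"
    by (simp flip: split)
qed

lemma support_le_of_moment_preserving_kernel:
  fixes \<mu> \<nu> :: "(real ^ 'n) measure"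
  assumes \<mu>: "\<mu> \<in> M1" and \<nu>: "\<nu> \<in> M1" and q: "q \<in> moment_preserving_kernels \<mu> \<nu>"
  shows "\<mu> \<preceq>\<^sub>s \<nu>"
  unfolding support_le_def
proof (intro allI impI)
  fix f :: "real ^ 'n \<Rightarrow> real" assume f: "support_function f"
  have tr: "transports q \<mu> \<nu>"
    using q M1_D(1)[OF \<nu>] unfolding transports_def measurable_cong_sets[OF M1_D(1)[OF \<mu>] refl]
    by (auto simp: moment_preserving_kernels_def transport_kernels_def unnormalized_kernel_def)
  have q_mom: "AE x in \<mu>. has_bochner_integral (q x) (\<lambda>y. y) x"
    using q by (auto simp: moment_preserving_kernels_def)
  note K = integral_kernel[OF tr support_function_integrable[OF f \<nu>]]
  have "(LINT x|\<mu>. f x) \<le> (LINT x|\<mu>. kernel_integral q f x)"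
  proof (rule integral_mono_AE)
    show "integrable \<mu> f" by (rule support_function_integrable[OF f \<mu>])
    show "integrable \<mu> (kernel_integral q f)" by (rule K(1))
    show "AE x in \<mu>. f x \<le> kernel_integral q f x"
      using K(2) q_mom by eventually_elim (rule support_function_Jensen[OF f])
  qed
  then show "(LINT x|\<mu>. f x) \<le> (LINT x|\<nu>. f x)" by (simp add: K(3))
qed

section \<open>A Borel coding of Euclidean space by the unit interval\<close>

text \<open>
  Only the digits 0 and 1 are used in base 4, so the tail of the series after any place is at most a
  third of that place. No carry can occur and the expansion is unique, unlike in base 2.
\<close>
lemma odd_floor_base_four:
  fixes z :: "nat \<Rightarrow> bool"
  shows "odd \<lfloor>4 ^ Suc n * (\<Sum>k. of_bool (z k) / 4 ^ Suc k :: real)\<rfloor> \<longleftrightarrow> z n"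
    and "0 \<le> (\<Sum>k. of_bool (z k) / 4 ^ Suc k :: real)"
    and "(\<Sum>k. of_bool (z k) / 4 ^ Suc k :: real) \<le> 1 / 3"
proof -
  define T where "T z = (\<Sum>k. of_bool (z k) / 4 ^ Suc k :: real)" for z
  have geo: "(\<lambda>k. 1 / 4 ^ Suc k :: real) sums (1 / 3)"
    using sums_mult[OF geometric_sums[of "1 / 4 :: real"], of "1 / 4"] by (simp add: power_divide)
  have sm: "summable (\<lambda>k. of_bool (z k) / 4 ^ Suc k :: real)" for z
    by (rule summable_comparison_test[OF _ sums_summable[OF geo]]) (auto intro!: exI[of _ 0])
  have T0: "0 \<le> T z" for z
    unfolding T_def by (rule suminf_nonneg[OF sm]) auto
  have T1: "T z \<le> 1 / 3" for z
    unfolding T_def sums_unique[OF geo]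
    by (rule suminf_le[OF _ sm sums_summable[OF geo]]) auto
  have split: "4 * T z = of_bool (z 0) + T (\<lambda>k. z (Suc k))" for z
  proof -
    have "T z = (\<Sum>k. of_bool (z (Suc k)) / 4 ^ Suc (Suc k)) + of_bool (z 0) / 4"
      unfolding T_def by (subst suminf_split_head[OF sm]) simp
    also have "(\<Sum>k. of_bool (z (Suc k)) / 4 ^ Suc (Suc k) :: real) = T (\<lambda>k. z (Suc k)) / 4"
      unfolding T_def by (subst suminf_divide[OF sm, symmetric]) (simp add: mult.commute)
    finally show ?thesis by (simp add: field_simps)
  qed
  have "odd \<lfloor>4 ^ Suc n * T z\<rfloor> \<longleftrightarrow> z n"
  proof (induction n arbitrary: z)
    case 0
    have "\<lfloor>of_bool (z 0) + T (\<lambda>k. z (Suc k))\<rfloor> = (of_bool (z 0) :: int)"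
      using T0[of "\<lambda>k. z (Suc k)"] T1[of "\<lambda>k. z (Suc k)"] by (cases "z 0") (auto simp: floor_eq_iff)
    then show ?case by (simp add: split)
  next
    case (Suc n)
    have "4 ^ Suc (Suc n) * T z = 4 ^ Suc n * T (\<lambda>k. z (Suc k)) + of_int (4 ^ Suc n * of_bool (z 0))"
    proof -
      have "4 ^ Suc (Suc n) * T z = 4 ^ Suc n * (4 * T z)" by simp
      then show ?thesis unfolding split by (simp add: algebra_simps)
    qed
    then have "\<lfloor>4 ^ Suc (Suc n) * T z\<rfloor> = \<lfloor>4 ^ Suc n * T (\<lambda>k. z (Suc k))\<rfloor> + 4 ^ Suc n * of_bool (z 0)"
      by (simp only: floor_add_int)
    then show ?case using Suc.IH[of "\<lambda>k. z (Suc k)"] by simp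
  qed
  then show "odd \<lfloor>4 ^ Suc n * (\<Sum>k. of_bool (z k) / 4 ^ Suc k :: real)\<rfloor> \<longleftrightarrow> z n"
    and "0 \<le> (\<Sum>k. of_bool (z k) / 4 ^ Suc k :: real)"
    and "(\<Sum>k. of_bool (z k) / 4 ^ Suc k :: real) \<le> 1 / 3"
    using T0 T1 unfolding T_def by auto
qed

text \<open>
  A point is determined by the countably many bits telling which rationals lie below which
  coordinate. Writing these bits as digits gives \<open>c\<close>, and each coordinate is recovered as the
  supremum of the rationals whose bit is set. The Borel left inverse
  carries kernels on the line back to Euclidean space.
\<close>
lemma borel_code_unit_interval:
  obtains c :: "'a::euclidean_space \<Rightarrow> real" and g :: "real \<Rightarrow> 'a"
  where "c \<in> borel_measurable borel" "g \<in> borel_measurable borel"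
    "\<And>x. g (c x) = x" "\<And>x. 0 \<le> c x" "\<And>x. c x \<le> 1"
proof -
  let ?I = "(Basis :: 'a set) \<times> (UNIV :: rat set)"
  have cI: "countable ?I"
    by (simp add: countable_finite)
  define e where "e = from_nat_into ?I"
  define j where "j = to_nat_on ?I"
  have ej: "e (j (b, q)) = (b, q)" if "b \<in> Basis" for b :: 'a and q :: rat
    unfolding e_def j_def using that by (intro from_nat_into_to_nat_on[OF cI]) auto
  define z where "z x k \<longleftrightarrow> of_rat (snd (e k)) < x \<bullet> fst (e k)" for x :: 'a and k
  define c where "c x = (\<Sum>k. of_bool (z x k) / 4 ^ Suc k :: real)" for x :: 'a
  define h where "h b t = (SUP q. if odd \<lfloor>4 ^ Suc (j (b, q)) * t\<rfloor> then ereal (of_rat q) else -\<infinity>)"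
    for b :: 'a and t :: real
  define g where "g t = (\<Sum>b\<in>Basis. real_of_ereal (h b t) *\<^sub>R b)" for t :: real
  have zm[measurable]: "Measurable.pred borel (\<lambda>x. z x k)" for k
    unfolding z_def by measurable
  have "(\<lambda>x. of_bool (z x k)) = (\<lambda>x. if z x k then 1 else 0 :: real)" for k
    by auto
  then have [measurable]: "(\<lambda>x. of_bool (z x k) :: real) \<in> borel_measurable borel" for k
    by simp
  have mc: "c \<in> borel_measurable borel"
    unfolding c_def[abs_def] by measurable
  have [measurable]: "Measurable.pred borel (\<lambda>t. odd \<lfloor>4 ^ Suc k * t :: real\<rfloor>)" for k
    by measurable
  have [measurable]: "h b \<in> borel_measurable borel" for b
    unfolding h_def[abs_def] by measurable
  have mg: "g \<in> borel_measurable borel"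
    unfolding g_def[abs_def] by measurable
  have "real_of_ereal (h b (c x)) = x \<bullet> b" if b: "b \<in> Basis" for b x
  proof -
    have "h b (c x) = (SUP q. if of_rat q < x \<bullet> b then ereal (of_rat q) else -\<infinity>)"
      unfolding h_def c_def odd_floor_base_four z_def ej[OF b] by simp
    also have "\<dots> = ereal (x \<bullet> b)"
    proof (rule antisym)
      show "(SUP q. if of_rat q < x \<bullet> b then ereal (of_rat q) else -\<infinity>) \<le> ereal (x \<bullet> b)"
        by (rule SUP_least) auto
      show "ereal (x \<bullet> b) \<le> (SUP q. if of_rat q < x \<bullet> b then ereal (of_rat q) else -\<infinity>)"
      proof (rule dense_le)
        fix y assume "y < ereal (x \<bullet> b)"
        then show "y \<le> (SUP q. if of_rat q < x \<bullet> b then ereal (of_rat q) else -\<infinity>)"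
        proof (cases y)
          case (real r)
          then obtain q where q: "r < of_rat q" "of_rat q < x \<bullet> b"
            using \<open>y < _\<close> of_rat_dense[of r "x \<bullet> b"] by auto
          show ?thesis
            by (rule SUP_upper2[of q]) (use q real in auto)
        qed auto
      qed
    qed
    finally show ?thesis by simp
  qed
  then have "g (c x) = x" for x
    unfolding g_def by (simp add: euclidean_representation)
  moreover have "0 \<le> c x" "c x \<le> 1" for x
    unfolding c_def using odd_floor_base_four(2,3)[of "z x"] by auto
  ultimately show ?thesis using that mc mg by blast
qed

section \<open>Nested closed convex sets of functions\<close>

text \<open>
  A substitute for weak compactness: near-minimizers of the \<open>L\<^sup>2\<close> norm on the sets \<open>C n\<close> are, by the
  parallelogram law applied to their midpoints, a Cauchy sequence. Choosing them fast enough makes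
  the sequence converge almost everywhere, and the limit lies in each \<open>C n\<close>.
\<close>
lemma nested_convex_Inter_nonempty:
  fixes C :: "nat \<Rightarrow> ('a \<Rightarrow> real) set"
  assumes "finite_measure M"
    and ne: "\<And>n. C n \<noteq> {}"
    and dec: "\<And>n. C (Suc n) \<subseteq> C n"
    and meas: "\<And>n f. f \<in> C n \<Longrightarrow> f \<in> borel_measurable M"
    and rng: "\<And>n f x. f \<in> C n \<Longrightarrow> 0 \<le> f x \<and> f x \<le> 1"
    and mid: "\<And>n f h. f \<in> C n \<Longrightarrow> h \<in> C n \<Longrightarrow> (\<lambda>x. (f x + h x) / 2) \<in> C n"
    and closed: "\<And>n F f. (\<And>k. F k \<in> C n) \<Longrightarrow> f \<in> borel_measurable M \<Longrightarrow> (\<And>x. 0 \<le> f x \<and> f x \<le> 1) \<Longrightarrow>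
      AE x in M. (\<lambda>k. F k x) \<longlonglongrightarrow> f x \<Longrightarrow> f \<in> C n"
  shows "(\<Inter>n. C n) \<noteq> {}"
proof -
  interpret finite_measure M by fact
  let ?m = "measure M (space M)"
  have int: "integrable M (\<lambda>x. (f x)\<^sup>2)" if "f \<in> C n" for f n
    by (rule integrable_const_bound[where B = 1])
      (use meas[OF that] rng[OF that] in \<open>auto simp: power_le_one_iff abs_square_le_1\<close>)
  define D where "D f = (LINT x|M. (f x)\<^sup>2)" for f :: "'a \<Rightarrow> real"
  have D0: "0 \<le> D f" for f unfolding D_def by simp
  have D1: "D f \<le> ?m" if "f \<in> C n" for f n
  proof -
    have "D f \<le> (LINT x|M. 1)" unfolding D_def
      by (rule integral_mono[OF int[OF that]]) (use rng[OF that] in \<open>auto simp: power_le_one\<close>)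
    then show ?thesis by simp
  qed
  define d where "d n = (INF f\<in>C n. D f)" for n
  have bdd: "bdd_below (D ` C n)" for n using D0 by (auto intro!: bdd_belowI[of _ 0])
  have dle: "d n \<le> D f" if "f \<in> C n" for f n
    unfolding d_def by (rule cINF_lower[OF bdd that])
  have C_mono: "C n \<subseteq> C m" if "m \<le> n" for m n
    using dec that by (rule lift_Suc_antimono_le)
  have "incseq d"
    unfolding d_def by (intro incseq_SucI cINF_superset_mono ne bdd dec) auto
  moreover have "bdd_above (range d)"
  proof (rule bdd_aboveI)
    fix x assume "x \<in> range d"
    then obtain n where "x = d n" by auto
    with dle D1 ne[of n] show "x \<le> ?m" by (metis all_not_in_conv order_trans)
  qed
  ultimately obtain l where l: "d \<longlonglongrightarrow> l" "\<And>n. d n \<le> l"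
    using LIMSEQ_incseq_SUP[of d] cSUP_upper[of _ UNIV d] by blast
  define e where "e k = (1 / 16 :: real) ^ k" for k
  have e0: "0 < e k" for k unfolding e_def by simp
  have e_Suc: "e (Suc k) \<le> e k" for k unfolding e_def by simp
  have "\<exists>s\<ge>k. \<exists>f. f \<in> C s \<and> l - e k < d s \<and> D f < l + e k" for k
  proof -
    have "\<forall>\<^sub>F s in sequentially. l - e k < d s"
      using l(1) e0[of k] by (intro order_tendstoD) auto
    then obtain s where s: "s \<ge> k" "l - e k < d s"
      unfolding eventually_sequentially by (meson nle_le)
    have "d s < l + e k" using l(2)[of s] e0[of k] by simp
    then obtain f where "f \<in> C s" "D f < l + e k"
      unfolding d_def using cINF_less_iff[OF ne bdd] by blast
    with s show ?thesis by blast
  qed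
  then obtain s f where s: "\<And>k. s k \<ge> k" "\<And>k. f k \<in> C (s k)" "\<And>k. l - e k < d (s k)"
    "\<And>k. D (f k) < l + e k"
    by metis
  note [measurable] = meas[OF s(2)]
  \<comment> \<open>Parallelogram law; the midpoint lies in \<open>C a\<close>, so its norm cannot drop below \<open>d a\<close>.\<close>
  have step: "(LINT x|M. (f (Suc k) x - f k x)\<^sup>2) \<le> 8 * e k" for k
  proof -
    define a where "a = min (s k) (s (Suc k))"
    have a: "l - e k \<le> d a"
      using s(3)[of k] s(3)[of "Suc k"] e_Suc[of k] by (auto simp: a_def min_def)
    have fa: "f k \<in> C a" "f (Suc k) \<in> C a"
      using s(2) C_mono unfolding a_def by (meson min.cobounded1 min.cobounded2 subsetD)+
    note m = mid[OF fa]
    have "(f (Suc k) x - f k x)\<^sup>2 = 2 * (f (Suc k) x)\<^sup>2 + 2 * (f k x)\<^sup>2 - 4 * ((f k x + f (Suc k) x) / 2)\<^sup>2" for x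
      by (simp add: power2_eq_square field_simps)
    then have "(LINT x|M. (f (Suc k) x - f k x)\<^sup>2) = 2 * D (f (Suc k)) + 2 * D (f k) - 4 * D (\<lambda>x. (f k x + f (Suc k) x) / 2)"
      unfolding D_def using int[OF fa(1)] int[OF fa(2)] int[OF m] by simp
    also have "\<dots> \<le> 2 * (l + e k) + 2 * (l + e k) - 4 * (l - e k)"
      using s(4)[of k] s(4)[of "Suc k"] dle[OF m] a e_Suc[of k] by simp
    finally show ?thesis by simp
  qed
  have intd: "integrable M (\<lambda>x. (f (Suc k) x - f k x)\<^sup>2)" for k
    by (rule integrable_const_bound[where B = 1])
      (use rng[OF s(2)[of k]] rng[OF s(2)[of "Suc k"]] in \<open>auto simp: abs_square_le_1 abs_le_iff intro!: AE_I2, smt+\<close>)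
  have intd1: "integrable M (\<lambda>x. \<bar>f (Suc k) x - f k x\<bar>)" for k
    by (rule integrable_const_bound[where B = 1])
      (use rng[OF s(2)[of k]] rng[OF s(2)[of "Suc k"]] in \<open>auto simp: abs_le_iff intro!: AE_I2, smt+\<close>)
  \<comment> \<open>Arithmetic and geometric mean: \<open>2 \<bar>u\<bar> \<le> 4 ^ k * u\<^sup>2 + 4 ^ -k\<close>.\<close>
  have step1: "(LINT x|M. \<bar>f (Suc k) x - f k x\<bar>) \<le> (8 + ?m) * (1 / 4) ^ k" for k
  proof -
    have "(LINT x|M. \<bar>f (Suc k) x - f k x\<bar>) \<le> (LINT x|M. 4 ^ k * (f (Suc k) x - f k x)\<^sup>2 + (1 / 4) ^ k)"
    proof (rule integral_mono)
      fix x
      let ?a = "\<bar>f (Suc k) x - f k x\<bar>"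
      have "0 \<le> (2 ^ k * ?a - (1 / 2) ^ k)\<^sup>2" by simp
      also have "\<dots> = 4 ^ k * ?a\<^sup>2 - 2 * ?a + (1 / 4) ^ k"
        by (simp add: power2_diff power_mult_distrib power_even_eq[symmetric] power_mult[symmetric] power_divide)
          (simp add: power_mult mult.commute[of k])
      finally have "2 * ?a \<le> 4 ^ k * (f (Suc k) x - f k x)\<^sup>2 + (1 / 4) ^ k" by simp
      then show "?a \<le> 4 ^ k * (f (Suc k) x - f k x)\<^sup>2 + (1 / 4) ^ k"
        by (rule order_trans[rotated]) simp
    qed (use intd intd1 in auto)
    also have "\<dots> = 4 ^ k * (LINT x|M. (f (Suc k) x - f k x)\<^sup>2) + ?m * (1 / 4) ^ k"
      using intd by simp
    also have "\<dots> \<le> 4 ^ k * (8 * e k) + ?m * (1 / 4) ^ k"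
      using step[of k] by (intro add_mono mult_left_mono) auto
    also have "4 ^ k * (8 * e k) = 8 * (1 / 4) ^ k"
      unfolding e_def by (simp add: power_divide field_simps flip: power_mult_distrib)
    finally show ?thesis by (simp add: algebra_simps)
  qed
  have "(\<integral>\<^sup>+x. (\<Sum>k. ennreal \<bar>f (Suc k) x - f k x\<bar>) \<partial>M) = (\<Sum>k. \<integral>\<^sup>+x. ennreal \<bar>f (Suc k) x - f k x\<bar> \<partial>M)"
    by (rule nn_integral_suminf) measurable
  also have "\<dots> \<le> (\<Sum>k. ennreal ((8 + ?m) * (1 / 4) ^ k))"
    by (intro suminf_le summableI) (use step1 in \<open>auto simp: nn_integral_eq_integral[OF intd1]\<close>)
  also have "\<dots> < \<infinity>"
    by (subst suminf_ennreal2) (auto intro!: summable_mult)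
  finally have "AE x in M. (\<Sum>k. ennreal \<bar>f (Suc k) x - f k x\<bar>) \<noteq> \<infinity>"
    by (intro nn_integral_PInf_AE) auto
  then have conv: "AE x in M. convergent (\<lambda>k. f k x)"
  proof eventually_elim
    fix x assume "(\<Sum>k. ennreal \<bar>f (Suc k) x - f k x\<bar>) \<noteq> \<infinity>"
    then have "summable (\<lambda>k. \<bar>f (Suc k) x - f k x\<bar>)"
      by (intro summable_suminf_not_top) auto
    then have "summable (\<lambda>k. f (Suc k) x - f k x)"
      by (rule summable_rabs_cancel)
    then have "convergent (\<lambda>n. \<Sum>k<n. f (Suc k) x - f k x)"
      by (simp add: summable_iff_convergent)
    then show "convergent (\<lambda>k. f k x)"
      unfolding sum_lessThan_telescope[of "\<lambda>k. f k x"] by (simp add: convergent_diff_const_right_iff)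
  qed
  define g where "g x = (if convergent (\<lambda>k. f k x) then lim (\<lambda>k. f k x) else 0)" for x
  have [measurable]: "Measurable.pred M (\<lambda>x. convergent (\<lambda>k. f k x))"
    unfolding Cauchy_convergent_iff[symmetric] pred_def
    by (rule sets_Collect_Cauchy) (rule meas[OF s(2)])
  have gm: "g \<in> borel_measurable M"
    unfolding g_def[abs_def]
    by (rule measurable_If[OF borel_measurable_lim_metric]) (simp_all add: meas[OF s(2)])
  have g01: "0 \<le> g x \<and> g x \<le> 1" for x
  proof (cases "convergent (\<lambda>k. f k x)")
    case True
    then have "(\<lambda>k. f k x) \<longlonglongrightarrow> g x" by (simp add: g_def convergent_LIMSEQ_iff)
    then show ?thesis
      using rng[OF s(2)] by (intro conjI LIMSEQ_le_const LIMSEQ_le_const2) auto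
  qed (simp add: g_def)
  have g_lim: "AE x in M. (\<lambda>k. f k x) \<longlonglongrightarrow> g x"
    using conv by eventually_elim (simp add: g_def convergent_LIMSEQ_iff)
  have "g \<in> C n" for n
  proof (rule closed[of "\<lambda>k. f (k + n)"])
    show "f (k + n) \<in> C n" for k
      using s(2)[of "k + n"] C_mono[of n "s (k + n)"] s(1)[of "k + n"] by auto
    show "AE x in M. (\<lambda>k. f (k + n) x) \<longlonglongrightarrow> g x"
      using g_lim by eventually_elim (rule LIMSEQ_ignore_initial_segment)
  qed (rule gm g01)+
  then show ?thesis by blast
qed

section \<open>Kernels from distribution functions\<close>

text \<open>
  Values on the rationals need not be right-continuous. The infimum over larger rationals is their
  right-continuous version, and it agrees with limits along rationals that decrease strictly to
  \<open>t\<close>.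
\<close>
lemma distribution_function_of_rational_values:
  fixes w :: "rat \<Rightarrow> real"
  assumes mono: "\<And>r s. r \<le> s \<Longrightarrow> w r \<le> w s"
    and low: "\<And>r. r < 0 \<Longrightarrow> w r = 0" and high: "\<And>r. 1 \<le> r \<Longrightarrow> w r = 1"
  defines "F \<equiv> \<lambda>t. INF r\<in>{r. t < of_rat r}. w r"
  shows "real_distribution (interval_measure F)"
    and "measure (interval_measure F) {..t} = F t"
    and "(\<And>n. t < of_rat (q n)) \<Longrightarrow> (\<lambda>n. of_rat (q n)) \<longlonglongrightarrow> t \<Longrightarrow> (\<lambda>n. w (q n)) \<longlonglongrightarrow> F t"
proof -
  have w0: "0 \<le> w r" for r
  proof -
    have "w (min r (- 1)) = 0" by (rule low) (auto simp: min_less_iff_disj)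
    with mono[of "min r (- 1)" r] show ?thesis by simp
  qed
  have ne: "{r. t < real_of_rat r} \<noteq> {}" for t
    using of_rat_dense[of t "t + 1"] by auto
  have bdd: "bdd_below (w ` A)" for A using w0 by (auto intro!: bdd_belowI[of _ 0])
  have F_le: "F t \<le> w r" if "t < of_rat r" for t r
    unfolding F_def by (rule cINF_lower[OF bdd]) (use that in auto)
  have F_ge: "b \<le> F t" if "\<And>r. t < of_rat r \<Longrightarrow> b \<le> w r" for t b
    unfolding F_def by (rule cINF_greatest[OF ne]) (use that in auto)
  have F_less: "\<exists>r. t < of_rat r \<and> w r < b" if "F t < b" for t b
    using that unfolding F_def by (subst (asm) cINF_less_iff[OF ne bdd]) auto
  have F_mono: "F s \<le> F t" if "s \<le> t" for s t
    by (rule F_ge, rule F_le) (use that in auto)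
  have rc: "continuous (at_right a) F" for a
    unfolding continuous_within
  proof (rule order_tendstoI)
    fix b assume "b < F a"
    then show "\<forall>\<^sub>F x in at_right a. b < F x"
      unfolding eventually_at_right_field by (intro exI[of _ "a + 1"]) (auto elim!: less_le_trans intro!: F_mono)
  next
    fix b assume "F a < b"
    then obtain r where r: "a < of_rat r" "w r < b" using F_less by blast
    then show "\<forall>\<^sub>F x in at_right a. F x < b"
      unfolding eventually_at_right_field using F_le[of _ r] by (intro exI[of _ "of_rat r"]) force
  qed
  have neg: "F t = 0" if t0: "t < 0" for t
  proof (rule antisym)
    obtain r where "t < of_rat r" "real_of_rat r < 0" using of_rat_dense[OF t0] by blast
    then show "F t \<le> 0" using F_le[of t r] low[of r] by (simp add: of_rat_less_0_iff)
  qed (rule F_ge, rule w0)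
  have ge1: "F t = 1" if "1 \<le> t" for t
  proof (rule antisym)
    obtain r where r: "t < of_rat r" using ne[of t] by blast
    with that have "1 < real_of_rat r" by (rule le_less_trans)
    then show "F t \<le> 1" using F_le[OF r] high[of r] by (simp add: one_less_of_rat_iff)
    show "1 \<le> F t"
    proof (rule F_ge)
      fix r assume "t < real_of_rat r"
      with that have "1 < real_of_rat r" by (rule le_less_trans)
      then show "1 \<le> w r" using high[of r] by (simp add: one_less_of_rat_iff)
    qed
  qed
  have bot: "(F \<longlongrightarrow> 0) at_bot"
    by (rule tendsto_eventually) (auto simp: eventually_at_bot_dense intro!: exI[of _ 0] neg)
  have top: "(F \<longlongrightarrow> 1) at_top"
    by (rule tendsto_eventually) (auto simp: eventually_at_top_linorder intro!: exI[of _ 1] ge1)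
  show "real_distribution (interval_measure F)"
    by (rule real_distribution_interval_measure[OF F_mono rc bot top])
  show "measure (interval_measure F) {..t} = F t"
    by (rule measure_interval_measure_Iic[OF F_mono rc bot])
  show "(\<lambda>n. w (q n)) \<longlonglongrightarrow> F t" if q: "\<And>n. t < of_rat (q n)" "(\<lambda>n. of_rat (q n)) \<longlonglongrightarrow> t" for q
  proof (rule order_tendstoI)
    fix b assume "b < F t"
    then show "\<forall>\<^sub>F n in sequentially. b < w (q n)"
      using F_le[OF q(1)] by (intro always_eventually allI) (erule less_le_trans)
  next
    fix b assume "F t < b"
    then obtain r where r: "t < of_rat r" "w r < b" using F_less by blast
    have "\<forall>\<^sub>F n in sequentially. of_rat (q n) < real_of_rat r"
      using q(2) r(1) by (rule order_tendstoD)
    then show "\<forall>\<^sub>F n in sequentially. w (q n) < b"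
    proof (rule eventually_mono)
      fix n assume "of_rat (q n) < real_of_rat r"
      then have "q n \<le> r" by (simp add: of_rat_less)
      from le_less_trans[OF mono[OF this] r(2)] show "w (q n) < b" .
    qed
  qed
qed

text \<open>
  Passes from weights on the half lines \<open>{y. c y \<le> r}\<close> to a probability kernel. The kernel is
  determined by \<open>W\<close> alone and satisfies all integral identities that hold for these half lines.
  It is applied in two ways. To construct the kernel towards \<open>\<mu>\<close> the identities are
  vector-valued, with \<open>\<phi>\<close> and \<open>\<psi>\<close> the identity maps; to reverse that kernel they are
  scalar and \<open>\<psi>\<close> is its mass on an arbitrary set.
\<close>
lemma kernel_of_distribution_functions:
  fixes W :: "rat \<Rightarrow> 'a \<Rightarrow> real" and c :: "'b::euclidean_space \<Rightarrow> real"
  assumes c[measurable]: "c \<in> borel_measurable borel" and g[measurable]: "g \<in> borel_measurable borel"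
    and gc: "\<And>y. g (c y) = y" and c1: "\<And>y. c y \<le> 1"
    and W[measurable]: "\<And>r. W r \<in> borel_measurable N"
    and mono: "AE x in N. \<forall>r s. r \<le> s \<longrightarrow> W r x \<le> W s x"
    and low: "AE x in N. \<forall>r<0. W r x = 0" and high: "AE x in N. \<forall>r\<ge>1. W r x = 1"
  shows "\<exists>k \<in> N \<rightarrow>\<^sub>M prob_algebra borel. \<forall>(\<phi> :: 'a \<Rightarrow> 'e::{banach, second_countable_topology}) \<Theta> \<psi>.
    integrable N \<phi> \<longrightarrow> sets \<Theta> = sets borel \<longrightarrow> integrable \<Theta> \<psi> \<longrightarrow>
    (\<forall>r. (LINT x|N. W r x *\<^sub>R \<phi> x) = (LINT y|\<Theta>. indicator {y. c y \<le> of_rat r} y *\<^sub>R \<psi> y)) \<longrightarrow>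
    (\<forall>E \<in> sets borel. (LINT x|N. measure (k x) E *\<^sub>R \<phi> x) = (LINT y|\<Theta>. indicator E y *\<^sub>R \<psi> y))"
proof -
  define good where "good x \<longleftrightarrow> (\<forall>r s. r \<le> s \<longrightarrow> W r x \<le> W s x) \<and> (\<forall>r<0. W r x = 0) \<and> (\<forall>r\<ge>1. W r x = 1)" for x
  have good_AE: "AE x in N. good x"
    using mono low high by eventually_elim (simp add: good_def)
  have [measurable]: "Measurable.pred N good"
    unfolding good_def[abs_def] by measurable
  \<comment> \<open>On the exceptional null set the weights are replaced by those of the unit mass at \<open>0\<close>.\<close>
  define V where "V r x = (if good x then W r x else if r < 0 then 0 else 1)" for r x
  have [measurable]: "V r \<in> borel_measurable N" for r
    unfolding V_def[abs_def] by measurable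
  have V: "r \<le> s \<Longrightarrow> V r x \<le> V s x" "r < 0 \<Longrightarrow> V r x = 0" "1 \<le> r \<Longrightarrow> V r x = 1" for r s x
    by (auto simp: V_def good_def)
  have V0: "0 \<le> V r x" for r x
  proof -
    have "V (min r (- 1)) x = 0" by (rule V) (auto simp: min_less_iff_disj)
    with V(1)[of "min r (- 1)" r x] show ?thesis by simp
  qed
  have V1: "V r x \<le> 1" for r x
    using V(1)[of r "max r 1" x] V(3)[of "max r 1" x] by simp
  have VW: "AE x in N. V r x = W r x" for r
    using good_AE by eventually_elim (simp add: V_def)
  define F where "F x t = (INF r\<in>{r. t < of_rat r}. V r x)" for x and t :: real
  have [measurable]: "(\<lambda>x. F x t) \<in> borel_measurable N" for t
    unfolding F_def[abs_def] by measurable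
  define k0 where "k0 x = interval_measure (F x)" for x
  note df = distribution_function_of_rational_values[of "\<lambda>r. V r _", OF V, folded F_def k0_def]
  have k0_prob: "prob_space (k0 x)" for x
    using df(1)[of x] by (simp add: real_distribution_def F_def k0_def)
  have k0_Iic: "measure (k0 x) {..t} = F x t" for x t
    using df(2)[of x t] by (simp add: F_def k0_def)
  have k0_sets: "sets (k0 x) = sets borel" for x
    by (simp add: k0_def)
  have borel_sigma: "sets borel = sigma_sets UNIV (range (atMost :: real \<Rightarrow> _))"
    unfolding borel_eq_atMost by (rule sets_measure_of) auto
  have k0[measurable]: "k0 \<in> N \<rightarrow>\<^sub>M prob_algebra borel"
  proof (rule measurable_prob_algebra_generated[where \<Omega> = UNIV and G = "range atMost"])
    show "sets borel = sigma_sets UNIV (range (atMost :: real \<Rightarrow> _))"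
      by (rule borel_sigma)
    show "Int_stable (range (atMost :: real \<Rightarrow> _))"
      by (auto simp: Int_stable_def)
    show "(\<lambda>x. emeasure (k0 x) A) \<in> borel_measurable N" if "A \<in> range atMost" for A
    proof -
      obtain t where "A = {..t}" using \<open>A \<in> _\<close> by auto
      moreover have "emeasure (k0 x) {..t} = ennreal (F x t)" for x
        using k0_prob[of x] by (simp add: prob_space_def finite_measure.emeasure_eq_measure k0_Iic)
      ultimately show ?thesis by simp
    qed
  qed (auto simp: k0_prob k0_sets)
  define k where "k x = distr (k0 x) borel g" for x
  have "k \<in> N \<rightarrow>\<^sub>M prob_algebra borel"
    unfolding k_def[abs_def] by measurable
  moreover have "(LINT x|N. measure (k x) E *\<^sub>R \<phi> x) = (LINT y|\<Theta>. indicator E y *\<^sub>R \<psi> y)"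
    if \<phi>[measurable]: "integrable N \<phi>" and \<Theta>[measurable_cong]: "sets \<Theta> = sets borel"
      and \<psi>[measurable]: "integrable \<Theta> \<psi>"
      and eq: "\<And>r. (LINT x|N. W r x *\<^sub>R \<phi> x) = (LINT y|\<Theta>. indicator {y. c y \<le> of_rat r} y *\<^sub>R \<psi> y)"
      and E[measurable]: "E \<in> sets borel"
    for \<phi> :: "'a \<Rightarrow> 'e" and \<Theta> \<psi> E
  proof -
    have [measurable]: "\<psi> \<in> borel_measurable \<Theta>" "c \<in> borel_measurable \<Theta>"
      using \<psi> c by (simp_all add: measurable_cong_sets[OF \<Theta> refl])
    have eqV: "(LINT x|N. V r x *\<^sub>R \<phi> x) = (LINT y|\<Theta>. indicator {y. c y \<le> of_rat r} y *\<^sub>R \<psi> y)" for r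
      unfolding eq[symmetric] using VW[of r] by (intro integral_cong_AE) (auto elim: AE_mp)
    have Iic: "(LINT x|N. measure (k0 x) {..t} *\<^sub>R \<phi> x) = (LINT y|\<Theta>. indicator {..t} (c y) *\<^sub>R \<psi> y)" for t
    proof -
      have "\<exists>q. t < of_rat q \<and> of_rat q < t + 1 / Suc n" for n
        by (rule of_rat_dense) simp
      then obtain q where q: "\<And>n. t < of_rat (q n)" "\<And>n. of_rat (q n) < t + 1 / Suc n" by metis
      have lim: "(\<lambda>n. of_rat (q n)) \<longlonglongrightarrow> t"
      proof (rule tendsto_sandwich[of "\<lambda>_. t" _ _ "\<lambda>n. t + 1 / Suc n"])
        show "\<forall>\<^sub>F n in sequentially. t \<le> of_rat (q n)"
          using q(1) by (intro always_eventually allI less_imp_le)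
        show "\<forall>\<^sub>F n in sequentially. of_rat (q n) \<le> t + 1 / Suc n"
          using q(2) by (intro always_eventually allI less_imp_le)
        show "(\<lambda>n. t + 1 / Suc n) \<longlonglongrightarrow> t"
          using tendsto_add[OF tendsto_const LIMSEQ_inverse_real_of_nat, of t] by (simp add: inverse_eq_divide)
      qed simp
      show ?thesis
      proof (rule LIMSEQ_unique)
      show "(\<lambda>n. LINT x|N. V (q n) x *\<^sub>R \<phi> x) \<longlonglongrightarrow> (LINT x|N. measure (k0 x) {..t} *\<^sub>R \<phi> x)"
      proof (rule integral_dominated_convergence)
        show "integrable N (\<lambda>x. norm (\<phi> x))" using \<phi> by simp
        show "AE x in N. (\<lambda>n. V (q n) x *\<^sub>R \<phi> x) \<longlonglongrightarrow> measure (k0 x) {..t} *\<^sub>R \<phi> x"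
          unfolding k0_Iic F_def
          by (intro AE_I2 tendsto_intros distribution_function_of_rational_values(3) V q(1) lim)
        show "AE x in N. norm (V (q n) x *\<^sub>R \<phi> x) \<le> norm (\<phi> x)" for n
          using V0 V1 by (auto intro!: AE_I2 mult_left_le_one_le)
        show "(\<lambda>x. measure (k0 x) {..t} *\<^sub>R \<phi> x) \<in> borel_measurable N"
          unfolding k0_Iic by measurable
      qed measurable
      show "(\<lambda>n. LINT x|N. V (q n) x *\<^sub>R \<phi> x) \<longlonglongrightarrow> (LINT y|\<Theta>. indicator {..t} (c y) *\<^sub>R \<psi> y)"
        unfolding eqV
      proof (rule integral_dominated_convergence)
        show "integrable \<Theta> (\<lambda>x. norm (\<psi> x))" using \<psi> by simp
        show "AE y in \<Theta>. (\<lambda>n. indicator {y. c y \<le> of_rat (q n)} y *\<^sub>R \<psi> y) \<longlonglongrightarrow> indicator {..t} (c y) *\<^sub>R \<psi> y"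
        proof (intro AE_I2 tendsto_intros)
          fix y
          show "(\<lambda>n. indicator {y. c y \<le> of_rat (q n)} y :: real) \<longlonglongrightarrow> indicator {..t} (c y)"
          proof (cases "c y \<le> t")
            case True
            then have "c y \<le> of_rat (q n)" for n using q(1)[of n] by simp
            with True show ?thesis by (auto simp: indicator_def)
          next
            case False
            then have "\<forall>\<^sub>F n in sequentially. of_rat (q n) < c y"
              using lim by (intro order_tendstoD) auto
            then show ?thesis
              by (intro tendsto_eventually) (auto simp: indicator_def False elim: eventually_mono)
          qed
        qed
        show "AE y in \<Theta>. norm (indicator {y. c y \<le> of_rat (q n)} y *\<^sub>R \<psi> y) \<le> norm (\<psi> y)" for n
          by (auto simp: indicator_def intro!: AE_I2)
      qed measurable
      qed
    qed
    have total: "(LINT x|N. \<phi> x) = (LINT y|\<Theta>. \<psi> y)"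
      using eqV[of 1] c1 by (simp add: V indicator_def)
    have m[measurable]: "(\<lambda>x. measure (k0 x) A) \<in> borel_measurable N" if "A \<in> sets borel" for A
      using that by measurable
    have le1: "measure (k0 x) A \<le> 1" for x A
      using k0_prob[of x] by (rule prob_space.prob_le_1)
    have int_k0: "integrable N (\<lambda>x. measure (k0 x) A *\<^sub>R \<phi> x)" if "A \<in> sets borel" for A
      using le1 that by (intro Bochner_Integration.integrable_bound[OF \<phi>]) (auto intro!: AE_I2 mult_left_le_one_le)
    have int_c: "integrable \<Theta> (\<lambda>y. indicator A (c y) *\<^sub>R \<psi> y)" if "A \<in> sets borel" for A
      using that by (intro Bochner_Integration.integrable_bound[OF \<psi>]) (auto simp: indicator_def intro!: AE_I2)
    have main: "(LINT x|N. measure (k0 x) A *\<^sub>R \<phi> x) = (LINT y|\<Theta>. indicator A (c y) *\<^sub>R \<psi> y)"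
      if "A \<in> sets borel" for A
    proof -
      have "Int_stable (range (atMost :: real \<Rightarrow> _))" "range (atMost :: real \<Rightarrow> _) \<subseteq> Pow UNIV"
        by (auto simp: Int_stable_def)
      moreover have "A \<in> sigma_sets UNIV (range atMost)"
        using that by (simp add: borel_sigma)
      ultimately show ?thesis
      proof (induction rule: sigma_sets_induct_disjoint)
        case (basic A)
        then show ?case using Iic by auto
      next
        case empty
        then show ?case by simp
      next
        case (compl A)
        have A[measurable]: "A \<in> sets borel"
          using compl.hyps by (simp add: borel_sigma)
        have "measure (k0 x) (UNIV - A) = 1 - measure (k0 x) A" for x
          using prob_space.prob_compl[OF k0_prob[of x], of A] k0_sets[of x] sets_eq_imp_space_eq[OF k0_sets[of x]] by simp
        then have "(LINT x|N. measure (k0 x) (UNIV - A) *\<^sub>R \<phi> x) = (LINT x|N. \<phi> x) - (LINT x|N. measure (k0 x) A *\<^sub>R \<phi> x)"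
          using int_k0[OF A] \<phi> by (simp add: scaleR_diff_left)
        also have "\<dots> = (LINT y|\<Theta>. \<psi> y - indicator A (c y) *\<^sub>R \<psi> y)"
          using int_c[OF A] \<psi> by (simp add: total compl.IH)
        also have "\<dots> = (LINT y|\<Theta>. indicator (UNIV - A) (c y) *\<^sub>R \<psi> y)"
          by (intro Bochner_Integration.integral_cong) (auto simp: indicator_def)
        finally show ?case .
      next
        case (union B)
        have B[measurable]: "B i \<in> sets borel" for i
          using union.hyps(2) by (auto simp: borel_sigma)
        have [measurable]: "(\<Union>i. B i) \<in> sets borel"
          by (rule sets.countable_UN) (auto simp: B)
        have k0_sums: "(\<lambda>i. measure (k0 x) (B i)) sums measure (k0 x) (\<Union>i. B i)" for x
        proof -
          interpret prob_space "k0 x" by (rule k0_prob)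
          show ?thesis
            by (rule finite_measure_UNION[OF _ union.hyps(1)]) (simp add: k0_sets image_subset_iff B)
        qed
        have ind_sums: "(\<lambda>i. indicator (B i) (c y) :: real) sums indicator (\<Union>i. B i) (c y)" for y
          by (rule indicator_sums) (use union.hyps(1) in \<open>auto simp: disjoint_family_on_def\<close>)
        show ?case
        proof (rule LIMSEQ_unique)
          let ?P = "\<lambda>n. \<Sum>i<n. LINT x|N. measure (k0 x) (B i) *\<^sub>R \<phi> x"
          have "?P = (\<lambda>n. LINT x|N. (\<Sum>i<n. measure (k0 x) (B i)) *\<^sub>R \<phi> x)"
            using int_k0 by (simp add: scaleR_sum_left)
          also have "\<dots> \<longlonglongrightarrow> (LINT x|N. measure (k0 x) (\<Union>i. B i) *\<^sub>R \<phi> x)"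
          proof (rule integral_dominated_convergence)
            show "integrable N (\<lambda>x. norm (\<phi> x))" using \<phi> by simp
            show "AE x in N. (\<lambda>n. (\<Sum>i<n. measure (k0 x) (B i)) *\<^sub>R \<phi> x) \<longlonglongrightarrow> measure (k0 x) (\<Union>i. B i) *\<^sub>R \<phi> x"
              using k0_sums by (intro AE_I2 tendsto_intros) (simp add: sums_def)
            have "(\<Sum>i<n. measure (k0 x) (B i)) \<le> 1" for n x
              using sum_le_suminf[OF sums_summable[OF k0_sums[of x]], of "{..<n}"] sums_unique[OF k0_sums[of x]]
                le1[of x "\<Union>i. B i"] by (simp add: order_trans)
            then show "AE x in N. norm ((\<Sum>i<n. measure (k0 x) (B i)) *\<^sub>R \<phi> x) \<le> norm (\<phi> x)" for n
              by (auto intro!: AE_I2 mult_left_le_one_le simp: sum_nonneg)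
          qed measurable
          finally show "?P \<longlonglongrightarrow> (LINT x|N. measure (k0 x) (\<Union>i. B i) *\<^sub>R \<phi> x)" .
          have "?P = (\<lambda>n. LINT y|\<Theta>. (\<Sum>i<n. indicator (B i) (c y)) *\<^sub>R \<psi> y)"
            by (rule ext) (simp only: scaleR_sum_left union.IH Bochner_Integration.integral_sum[OF int_c[OF B]])
          also have "\<dots> \<longlonglongrightarrow> (LINT y|\<Theta>. indicator (\<Union>i. B i) (c y) *\<^sub>R \<psi> y)"
          proof (rule integral_dominated_convergence)
            show "integrable \<Theta> (\<lambda>x. norm (\<psi> x))" using \<psi> by simp
            show "AE y in \<Theta>. (\<lambda>n. (\<Sum>i<n. indicator (B i) (c y)) *\<^sub>R \<psi> y) \<longlonglongrightarrow> indicator (\<Union>i. B i) (c y) *\<^sub>R \<psi> y"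
              using ind_sums by (intro AE_I2 tendsto_intros) (simp add: sums_def)
            have "(\<Sum>i<n. indicator (B i) (c y) :: real) \<le> indicator (\<Union>i. B i) (c y)" for n y
              unfolding sums_unique[OF ind_sums[of y]]
              by (rule sum_le_suminf[OF sums_summable[OF ind_sums]]) auto
            then have "(\<Sum>i<n. indicator (B i) (c y) :: real) \<le> 1" for n y
              by (rule order_trans) (simp add: indicator_def)
            then show "AE y in \<Theta>. norm ((\<Sum>i<n. indicator (B i) (c y)) *\<^sub>R \<psi> y) \<le> norm (\<psi> y)" for n
              by (auto intro!: AE_I2 mult_left_le_one_le simp: sum_nonneg)
          qed measurable
          finally show "?P \<longlonglongrightarrow> (LINT y|\<Theta>. indicator (\<Union>i. B i) (c y) *\<^sub>R \<psi> y)" .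
        qed
      qed
    qed
    have "measure (k x) E = measure (k0 x) (g -` E)" for x
      unfolding k_def using sets_eq_imp_space_eq[OF k0_sets[of x]]
      by (subst measure_distr) (auto simp: measurable_cong_sets[OF k0_sets refl])
    moreover have "g -` E \<in> sets borel"
      using measurable_sets[OF g E] by simp
    ultimately show ?thesis
      using main[of "g -` E"] by (simp add: indicator_def gc)
  qed
  ultimately show ?thesis by blast
qed

section \<open>Partitions of unity with prescribed moments\<close>

lemma sum_inner_integral:
  fixes F :: "'i \<Rightarrow> 'a \<Rightarrow> 'b::euclidean_space"
  assumes "\<And>i. i \<in> I \<Longrightarrow> integrable M (F i)"
  shows "(\<Sum>i\<in>I. a i \<bullet> (LINT x|M. F i x)) = (LINT x|M. (\<Sum>i\<in>I. a i \<bullet> F i x))"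
    and "integrable M (\<lambda>x. (\<Sum>i\<in>I. a i \<bullet> F i x))"
  using assms by (simp_all add: Bochner_Integration.integral_sum)

lemma integral_linear_combination:
  fixes f h :: "'a \<Rightarrow> 'b::euclidean_space"
  assumes "integrable M f" "integrable M h"
  shows "(LINT x|M. s *\<^sub>R f x + t *\<^sub>R h x) = s *\<^sub>R (LINT x|M. f x) + t *\<^sub>R (LINT x|M. h x)"
  using assms by simp

text \<open>
  The squared error \<open>J w\<close> of a partition of unity \<open>w\<close> is driven to zero by moving a little towards
  the partition that maximizes the linearized gain. With \<open>a i\<close> the current error vectors, that
  partition assigns each \<open>y\<close> to the cells with the largest \<open>a i \<bullet> y\<close>, and \<open>\<mu> \<preceq>\<^sub>s \<nu>\<close>, applied to
  the support function \<open>max\<^sub>i a i \<bullet> y\<close>, bounds its gain from below by \<open>J w\<close>. This replaces the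
  separation theorem, in a form that does not depend on the number of cells.
\<close>
lemma partition_of_unity_approximating_moments:
  fixes \<mu> \<nu> :: "(real ^ 'n) measure" and \<kappa> :: "real ^ 'n \<Rightarrow> 'i"
  assumes \<mu>: "\<mu> \<in> M1" and \<nu>: "\<nu> \<in> M1" and le: "\<mu> \<preceq>\<^sub>s \<nu>"
    and I: "finite I" "range \<kappa> \<subseteq> I" and \<kappa>: "\<And>i. i \<in> I \<Longrightarrow> \<kappa> -` {i} \<in> sets borel"
    and \<epsilon>: "0 < \<epsilon>"
  obtains w where "\<And>i. w i \<in> borel_measurable borel" "\<And>i y. 0 \<le> w i y" "\<And>y. (\<Sum>i\<in>I. w i y) = 1"
    "\<And>i. i \<in> I \<Longrightarrow> norm ((LINT y|\<nu>. w i y *\<^sub>R y) - (LINT x|\<mu>. indicator (\<kappa> -` {i}) x *\<^sub>R x)) < \<epsilon>"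
proof -
  note [measurable_cong] = M1_D(1)[OF \<mu>] M1_D(1)[OF \<nu>]
  have ne: "I \<noteq> {}" using I(2) by auto
  define P where "P w \<longleftrightarrow> (\<forall>i. w i \<in> borel_measurable borel) \<and> (\<forall>i y. 0 \<le> w i y) \<and>
    (\<forall>y. (\<Sum>i\<in>I. w i y) = 1)" for w :: "'i \<Rightarrow> real ^ 'n \<Rightarrow> real"
  define b where "b w i = (LINT y|\<nu>. w i y *\<^sub>R y)" for w :: "'i \<Rightarrow> real ^ 'n \<Rightarrow> real" and i
  define m where "m i = (LINT x|\<mu>. indicator (\<kappa> -` {i}) x *\<^sub>R x)" for i
  define J where "J w = (\<Sum>i\<in>I. (norm (m i - b w i))\<^sup>2)" for w
  define L where "L = (LINT y|\<nu>. norm y)"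
  define D where "D = (\<Sum>i\<in>I. (2 * L)\<^sup>2)"
  have w_le: "w i y \<le> 1" if "P w" "i \<in> I" for w i y
    using member_le_sum[of i I "\<lambda>i. w i y"] that I by (auto simp: P_def)
  have int: "integrable \<nu> (\<lambda>y. w i y *\<^sub>R y)" if w: "P w" "i \<in> I" for w i
  proof (rule Bochner_Integration.integrable_bound[OF M1_D(4)[OF \<nu>]])
    have [measurable]: "w i \<in> borel_measurable borel" using w by (auto simp: P_def)
    show "(\<lambda>y. w i y *\<^sub>R y) \<in> borel_measurable \<nu>" by measurable
    show "AE y in \<nu>. norm (w i y *\<^sub>R y) \<le> norm (norm y)"
      using w_le[OF w] w(1) by (auto simp: P_def intro!: mult_left_le_one_le)
  qed
  have b_le: "norm (b w i) \<le> L" if w: "P w" "i \<in> I" for w i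
    unfolding b_def L_def using w_le[OF w] w(1)
    by (intro Bochner_Integration.integral_norm_bound_integral[OF int[OF w] M1_D(4)[OF \<nu>]])
       (auto simp: P_def intro!: mult_left_le_one_le)
  have improve: "\<exists>w'. P w' \<and> J w' \<le> (1 - 2 * t) * J w + t\<^sup>2 * D"
    if w: "P w" and t: "0 \<le> t" "t \<le> 1" for w t
  proof -
    define a where "a i = m i - b w i" for i
    define f where "f v = Max ((\<lambda>i. a i \<bullet> v) ` I)" for v
    have f: "support_function f"
      unfolding f_def[abs_def] using I(1) ne by (rule support_function_Max_inner)
    note [measurable] = support_function_measurable[OF f]
    have a_le: "a i \<bullet> v \<le> f v" if "i \<in> I" for i v
      unfolding f_def using I that by (intro Max_ge) auto
    have att: "\<exists>i\<in>I. a i \<bullet> v = f v" for v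
    proof -
      have "f v \<in> (\<lambda>i. a i \<bullet> v) ` I"
        unfolding f_def using I(1) ne by (intro Max_in) auto
      then show ?thesis by force
    qed
    \<comment> \<open>Ties between maximizing cells are split evenly, which keeps \<open>V\<close> measurable.\<close>
    define s where "s i y = (if a i \<bullet> y = f y then 1 else 0 :: real)" for i y
    have [measurable]: "s i \<in> borel_measurable borel" for i
      unfolding s_def[abs_def] by measurable
    define V where "V i y = s i y / (\<Sum>j\<in>I. s j y)" for i y
    have s_pos: "0 < (\<Sum>j\<in>I. s j y)" for y
    proof -
      obtain i where "i \<in> I" "a i \<bullet> y = f y" using att by blast
      then show ?thesis using I(1) by (intro sum_pos2[of _ i]) (auto simp: s_def)
    qed
    have V: "P V"
      unfolding P_def
    proof (intro conjI allI)
      show "V i \<in> borel_measurable borel" for i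
        unfolding V_def[abs_def] by measurable
      show "0 \<le> V i y" for i y
        using s_pos[of y] by (auto simp: V_def s_def)
      show "(\<Sum>i\<in>I. V i y) = 1" for y
        using s_pos[of y] by (simp add: V_def flip: sum_divide_distrib)
    qed
    have Vf: "(\<Sum>i\<in>I. V i y * (a i \<bullet> y)) = f y" for y
    proof -
      have "(\<Sum>i\<in>I. V i y * (a i \<bullet> y)) = (\<Sum>i\<in>I. V i y * f y)"
        by (rule sum.cong) (auto simp: V_def s_def)
      also have "\<dots> = f y"
        using V by (simp add: P_def flip: sum_distrib_right)
      finally show ?thesis .
    qed
    have int\<kappa>: "integrable \<mu> (\<lambda>x. indicator (\<kappa> -` {i}) x *\<^sub>R x)" if "i \<in> I" for i
      using M1_D(5)[OF \<mu>] \<kappa>[OF that] by (intro integrable_mult_indicator) (simp_all add: M1_D(1)[OF \<mu>])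
    have "(\<Sum>i\<in>I. a i \<bullet> m i) = (LINT x|\<mu>. (\<Sum>i\<in>I. a i \<bullet> (indicator (\<kappa> -` {i}) x *\<^sub>R x)))"
      unfolding m_def using int\<kappa> by (rule sum_inner_integral(1))
    also have "\<dots> \<le> (LINT x|\<mu>. f x)"
    proof (rule integral_mono)
      show "integrable \<mu> (\<lambda>x. (\<Sum>i\<in>I. a i \<bullet> (indicator (\<kappa> -` {i}) x *\<^sub>R x)))"
        using int\<kappa> by (rule sum_inner_integral(2))
      fix x
      have "(\<Sum>i\<in>I. a i \<bullet> (indicator (\<kappa> -` {i}) x *\<^sub>R x)) = (\<Sum>i\<in>{\<kappa> x}. a i \<bullet> x)"
        using I by (intro sum.mono_neutral_cong_right) (auto simp: indicator_def)
      then show "(\<Sum>i\<in>I. a i \<bullet> (indicator (\<kappa> -` {i}) x *\<^sub>R x)) \<le> f x"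
        using a_le[of "\<kappa> x" x] I(2) by auto
    qed (rule support_function_integrable[OF f \<mu>])
    also have "\<dots> \<le> (LINT y|\<nu>. f y)"
      using le f by (auto simp: support_le_def)
    also have "\<dots> = (LINT y|\<nu>. (\<Sum>i\<in>I. a i \<bullet> (V i y *\<^sub>R y)))"
      by (simp add: Vf[symmetric])
    also have "\<dots> = (\<Sum>i\<in>I. a i \<bullet> b V i)"
      unfolding b_def using int[OF V] by (rule sum_inner_integral(1)[symmetric])
    finally have am: "(\<Sum>i\<in>I. a i \<bullet> m i) \<le> (\<Sum>i\<in>I. a i \<bullet> b V i)" .
    have Jw: "J w = (\<Sum>i\<in>I. a i \<bullet> m i) - (\<Sum>i\<in>I. a i \<bullet> b w i)"
      unfolding J_def a_def[symmetric] power2_norm_eq_inner sum_subtractf[symmetric]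
      by (rule sum.cong) (simp_all add: a_def inner_diff_right)
    define w' where "w' i y = (1 - t) * w i y + t * V i y" for i y
    have "P w'"
      using w V t unfolding P_def w'_def[abs_def]
      by (auto simp: sum.distrib simp flip: sum_distrib_left
          intro!: borel_measurable_add borel_measurable_times)
    moreover have "J w' \<le> (1 - 2 * t) * J w + t\<^sup>2 * D"
    proof -
      have bw': "b w' i = b w i + t *\<^sub>R (b V i - b w i)" if "i \<in> I" for i
      proof -
        have "b w' i = (LINT y|\<nu>. (1 - t) *\<^sub>R (w i y *\<^sub>R y) + t *\<^sub>R (V i y *\<^sub>R y))"
          by (simp add: b_def w'_def scaleR_add_left)
        also have "\<dots> = (1 - t) *\<^sub>R b w i + t *\<^sub>R b V i"
          unfolding b_def by (rule integral_linear_combination[OF int[OF w that] int[OF V that]])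
        finally show ?thesis by (simp add: algebra_simps)
      qed
      have "J w' = (\<Sum>i\<in>I. (norm (a i))\<^sup>2 - 2 * t * (a i \<bullet> b V i - a i \<bullet> b w i) + t\<^sup>2 * (norm (b V i - b w i))\<^sup>2)"
        unfolding J_def
      proof (rule sum.cong)
        fix i assume "i \<in> I"
        then have eq: "m i - b w' i = a i - t *\<^sub>R (b V i - b w i)" by (simp add: bw' a_def)
        show "(norm (m i - b w' i))\<^sup>2 = (norm (a i))\<^sup>2 - 2 * t * (a i \<bullet> b V i - a i \<bullet> b w i) + t\<^sup>2 * (norm (b V i - b w i))\<^sup>2"
          unfolding eq power2_norm_eq_inner
          by (simp add: inner_diff_left inner_diff_right inner_commute algebra_simps power2_eq_square)
      qed simp
      also have "\<dots> = J w - 2 * t * ((\<Sum>i\<in>I. a i \<bullet> b V i) - (\<Sum>i\<in>I. a i \<bullet> b w i)) + t\<^sup>2 * (\<Sum>i\<in>I. (norm (b V i - b w i))\<^sup>2)"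
        by (simp add: J_def a_def[symmetric] sum.distrib sum_subtractf flip: sum_distrib_left)
      also have "\<dots> \<le> J w - 2 * t * J w + t\<^sup>2 * D"
      proof (intro add_mono diff_mono mult_left_mono)
        show "J w \<le> (\<Sum>i\<in>I. a i \<bullet> b V i) - (\<Sum>i\<in>I. a i \<bullet> b w i)"
          using am by (simp add: Jw)
        show "(\<Sum>i\<in>I. (norm (b V i - b w i))\<^sup>2) \<le> D"
          unfolding D_def
        proof (intro sum_mono power_mono)
          fix i assume "i \<in> I"
          then show "norm (b V i - b w i) \<le> 2 * L"
            using norm_triangle_ineq4[of "b V i" "b w i"] b_le[OF V] b_le[OF w] by force
        qed simp
      qed (use t in auto)
      finally show ?thesis by (simp add: algebra_simps)
    qed
    ultimately show ?thesis by blast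
  qed
  obtain i0 where i0: "i0 \<in> I" using ne by blast
  have "P (\<lambda>i y. if i = i0 then 1 else 0)"
    using i0 I(1) by (auto simp: P_def)
  then have Jne: "J ` {w. P w} \<noteq> {}" by blast
  have J0: "0 \<le> J w" for w unfolding J_def by (intro sum_nonneg) auto
  have bdd: "bdd_below (J ` {w. P w})" using J0 by (auto intro!: bdd_belowI[of _ 0])
  define \<delta> where "\<delta> = Inf (J ` {w. P w})"
  have \<delta>_le: "\<delta> \<le> J w" if "P w" for w
    unfolding \<delta>_def using that by (intro cInf_lower[OF _ bdd]) auto
  have D0: "0 \<le> D" unfolding D_def by (intro sum_nonneg) auto
  \<comment> \<open>A step of length \<open>t\<close> cannot lower the infimum \<open>\<delta>\<close>; letting \<open>t\<close> tend to 0 forces \<open>\<delta> \<le> 0\<close>.\<close>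
  have half: "2 * \<delta> \<le> t * D" if t: "0 < t" "t \<le> 1 / 2" for t
  proof -
    have "\<delta> \<le> (1 - 2 * t) * \<delta> + t\<^sup>2 * D"
    proof (rule field_le_epsilon)
      fix \<eta> :: real assume "0 < \<eta>"
      then have "Inf (J ` {w. P w}) < \<delta> + \<eta>" by (simp add: \<delta>_def)
      then obtain w where w: "P w" "J w < \<delta> + \<eta>"
        using cInf_less_iff[OF Jne bdd] by auto
      obtain w' where w': "P w'" "J w' \<le> (1 - 2 * t) * J w + t\<^sup>2 * D"
        using improve[OF w(1), of t] t by auto
      have "(1 - 2 * t) * J w \<le> (1 - 2 * t) * (\<delta> + \<eta>)"
        using t w(2) by (intro mult_left_mono) auto
      moreover have "(1 - 2 * t) * \<eta> \<le> \<eta>"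
        using t \<open>0 < \<eta>\<close> by (simp add: mult_left_le_one_le)
      ultimately show "\<delta> \<le> (1 - 2 * t) * \<delta> + t\<^sup>2 * D + \<eta>"
        using \<delta>_le[OF w'(1)] w'(2) by (simp add: algebra_simps)
    qed
    then have "t * (2 * \<delta>) \<le> t * (t * D)" by (simp add: algebra_simps power2_eq_square)
    then show ?thesis using t by simp
  qed
  have "\<delta> \<le> 0"
  proof (rule ccontr)
    assume "\<not> \<delta> \<le> 0"
    define t where "t = min (1 / 2) (\<delta> / (D + 1))"
    have t: "0 < t" "t \<le> 1 / 2" "t \<le> \<delta> / (D + 1)"
      using \<open>\<not> \<delta> \<le> 0\<close> D0 unfolding t_def by (simp_all only: min.cobounded1 min.cobounded2) simp
    have "t * D \<le> t * (D + 1)" using t by simp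
    also have "\<dots> \<le> \<delta>" using t(3) D0 by (simp add: field_simps)
    finally show False using half[OF t(1,2)] \<open>\<not> \<delta> \<le> 0\<close> by simp
  qed
  then have "Inf (J ` {w. P w}) < \<epsilon>\<^sup>2"
    using \<epsilon> by (simp add: \<delta>_def) (meson le_less_trans zero_less_power)
  then obtain w where w: "P w" "J w < \<epsilon>\<^sup>2"
    using cInf_less_iff[OF Jne bdd] by auto
  show ?thesis
  proof (rule that[of w])
    fix i assume "i \<in> I"
    then have "(norm (m i - b w i))\<^sup>2 \<le> J w"
      unfolding J_def using I(1) by (intro member_le_sum) auto
    then have "norm (m i - b w i) < \<epsilon>"
      using w(2) \<epsilon> by (intro power2_less_imp_less[of _ \<epsilon>]) auto
    then show "norm ((LINT y|\<nu>. w i y *\<^sub>R y) - (LINT x|\<mu>. indicator (\<kappa> -` {i}) x *\<^sub>R x)) < \<epsilon>"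
      by (simp add: b_def m_def norm_minus_commute)
  qed (use w in \<open>auto simp: P_def\<close>)
qed

lemma borel_measurable_pair_countable:
  fixes F :: "'a \<times> 'i::countable \<Rightarrow> real"
  assumes "\<And>i. (\<lambda>y. F (y, i)) \<in> borel_measurable M" "sets K = UNIV"
  shows "F \<in> borel_measurable (M \<Otimes>\<^sub>M K)"
proof -
  have K: "sets K = sets (count_space UNIV)" using assms(2) by simp
  have "(\<lambda>z. F (fst z, snd z)) \<in> borel_measurable (M \<Otimes>\<^sub>M K)"
  proof (rule measurable_compose_countable[where f = "\<lambda>i z. F (fst z, i)" and g = snd])
    show "(\<lambda>z. F (fst z, i)) \<in> borel_measurable (M \<Otimes>\<^sub>M K)" for i
      by (rule measurable_compose[OF measurable_fst assms(1)])
    show "snd \<in> M \<Otimes>\<^sub>M K \<rightarrow>\<^sub>M count_space UNIV"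
      using measurable_snd[of M K] measurable_cong_sets[OF refl K] by blast
  qed
  then show ?thesis by simp
qed

text \<open>
  For finitely many of the sets \<open>E i\<close>, a fractional version is obtained by summing the weights of
  the cells of the partition that they generate. Conditions on the first \<open>n\<close> sets, with moments
  correct up to \<open>1 / (n + 1)\<close>, are convex and closed, so they can be met for all \<open>n\<close> at once. The
  whole sequence \<open>W\<close> is treated as one function on the product of \<open>\<nu>\<close> with a probability measure
  of full support on the indices.
\<close>
lemma fractional_sets_with_prescribed_moments:
  fixes \<mu> \<nu> :: "(real ^ 'n) measure" and E :: "nat \<Rightarrow> (real ^ 'n) set"
  assumes \<mu>: "\<mu> \<in> M1" and \<nu>: "\<nu> \<in> M1" and le: "\<mu> \<preceq>\<^sub>s \<nu>"
    and E[measurable]: "\<And>i. E i \<in> sets borel"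
  obtains W where "\<And>i. W i \<in> borel_measurable \<nu>"
    "AE y in \<nu>. \<forall>i j. E i \<subseteq> E j \<longrightarrow> W i y \<le> W j y"
    "AE y in \<nu>. \<forall>i. E i = {} \<longrightarrow> W i y = 0"
    "AE y in \<nu>. \<forall>i. E i = UNIV \<longrightarrow> W i y = 1"
    "\<And>i. (LINT y|\<nu>. W i y *\<^sub>R y) = (LINT x|\<mu>. indicator (E i) x *\<^sub>R x)"
proof -
  note [measurable_cong] = M1_D(1)[OF \<mu>] M1_D(1)[OF \<nu>]
  interpret \<nu>: finite_measure \<nu> by (rule M1_D(2)[OF \<nu>])
  \<comment> \<open>The geometric distribution charges every index, so null sets of the product are null for each index.\<close>
  define K where "K = measure_pmf (geometric_pmf (1 / 2))"
  interpret K: prob_space K unfolding K_def by (rule prob_space_measure_pmf)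
  have K_AE: "(AE i in K. Q i) \<longleftrightarrow> (\<forall>i. Q i)" for Q
    unfolding K_def by (simp add: AE_measure_pmf_iff set_pmf_geometric)
  have K_sets: "sets K = UNIV" unfolding K_def by simp
  interpret P: pair_sigma_finite \<nu> K ..
  have fin: "finite_measure (\<nu> \<Otimes>\<^sub>M K)"
    by (rule finite_measure_pair_measure) (unfold_locales)
  define b where "b f i = (LINT y|\<nu>. f (y, i) *\<^sub>R y)" for f :: "(real ^ 'n) \<times> nat \<Rightarrow> real" and i
  define m where "m i = (LINT x|\<mu>. indicator (E i) x *\<^sub>R x)" for i
  define admissible where "admissible n w \<longleftrightarrow> (\<forall>i<n. \<forall>j<n. (E i \<subseteq> E j \<longrightarrow> w i \<le> w j) \<and>
    (E i = {} \<longrightarrow> w i = 0) \<and> (E i = UNIV \<longrightarrow> w i = 1))" for n and w :: "nat \<Rightarrow> real"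
  define C where "C n = {f. f \<in> borel_measurable (\<nu> \<Otimes>\<^sub>M K) \<and> (\<forall>z. 0 \<le> f z \<and> f z \<le> 1) \<and>
    (AE y in \<nu>. admissible n (\<lambda>i. f (y, i))) \<and> (\<forall>i<n. norm (b f i - m i) \<le> 1 / Suc n)}" for n
  have sec: "(\<lambda>y. f (y, i)) \<in> borel_measurable \<nu>" if "f \<in> borel_measurable (\<nu> \<Otimes>\<^sub>M K)" for f :: "_ \<Rightarrow> real" and i
    by (rule measurable_compose[OF _ that]) (simp add: K_def)
  have int: "integrable \<nu> (\<lambda>y. f (y, i) *\<^sub>R y)"
    if f: "f \<in> borel_measurable (\<nu> \<Otimes>\<^sub>M K)" "\<And>z. 0 \<le> f z \<and> f z \<le> 1" for f :: "_ \<Rightarrow> real" and i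
  proof (rule Bochner_Integration.integrable_bound[OF M1_D(4)[OF \<nu>]])
    note [measurable] = sec[OF f(1)]
    show "(\<lambda>y. f (y, i) *\<^sub>R y) \<in> borel_measurable \<nu>" by measurable
    show "AE y in \<nu>. norm (f (y, i) *\<^sub>R y) \<le> norm (norm y)"
      using f(2) by (auto intro!: mult_left_le_one_le)
  qed
  have nonempty: "C n \<noteq> {}" for n
  proof -
    define \<kappa> where "\<kappa> x = {i. i < n \<and> x \<in> E i}" for x
    define I where "I = range \<kappa>"
    have I_sub: "I \<subseteq> Pow {..<n}" by (auto simp: I_def \<kappa>_def)
    have I: "finite I" by (rule finite_subset[OF I_sub]) simp
    have I0: "0 < card I" using I by (auto simp: card_gt_0_iff I_def)
    have \<kappa>: "\<kappa> -` {S} \<in> sets borel" if "S \<in> I" for S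
    proof -
      have "\<kappa> -` {S} = {x \<in> space borel. \<forall>i\<in>{..<n}. x \<in> E i \<longleftrightarrow> i \<in> S}"
        unfolding \<kappa>_def using that I_sub by (simp add: set_eq_iff subset_eq) blast
      also have "\<dots> \<in> sets borel" by measurable
      finally show ?thesis .
    qed
    \<comment> \<open>Each moment is a sum over at most \<open>card I\<close> cells, each correct up to \<open>\<epsilon>\<close>.\<close>
    define \<epsilon> where "\<epsilon> = 1 / (real (Suc n) * real (card I))"
    have "0 < \<epsilon>"
      unfolding \<epsilon>_def using I0 by (intro divide_pos_pos mult_pos_pos) simp_all
    then obtain w where w: "\<And>i. w i \<in> borel_measurable borel" "\<And>i y. 0 \<le> w i y" "\<And>y. (\<Sum>i\<in>I. w i y) = 1"
      and wm: "\<And>i. i \<in> I \<Longrightarrow> norm ((LINT y|\<nu>. w i y *\<^sub>R y) - (LINT x|\<mu>. indicator (\<kappa> -` {i}) x *\<^sub>R x)) < \<epsilon>"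
      using partition_of_unity_approximating_moments[OF \<mu> \<nu> le I _ \<kappa>, of \<epsilon>] I_def by blast
    note [measurable] = w(1)
    define f where "f z = (if snd z < n then \<Sum>S\<in>{S\<in>I. snd z \<in> S}. w S (fst z) else 0)" for z
    have f01: "0 \<le> f z \<and> f z \<le> 1" for z
    proof -
      have "(\<Sum>S\<in>{S\<in>I. snd z \<in> S}. w S (fst z)) \<le> (\<Sum>S\<in>I. w S (fst z))"
        using I w(2) by (intro sum_mono2) auto
      then show ?thesis using w(2) by (auto simp: f_def w(3) intro!: sum_nonneg)
    qed
    have fm: "f \<in> borel_measurable (\<nu> \<Otimes>\<^sub>M K)"
    proof (rule borel_measurable_pair_countable[OF _ K_sets])
      fix i show "(\<lambda>y. f (y, i)) \<in> borel_measurable \<nu>"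
        unfolding f_def fst_conv snd_conv by measurable
    qed
    have "admissible n (\<lambda>i. f (y, i))" for y
      unfolding admissible_def
    proof (intro allI impI conjI)
      fix i j assume ij: "i < n" "j < n"
      show "f (y, i) \<le> f (y, j)" if "E i \<subseteq> E j"
        unfolding f_def using ij that I w(2) by (auto intro!: sum_mono2 simp: I_def \<kappa>_def)
      show "f (y, i) = 0" if "E i = {}"
      proof -
        have "{S \<in> I. i \<in> S} = {}" using that by (auto simp: I_def \<kappa>_def)
        show ?thesis by (simp only: f_def fst_conv snd_conv \<open>{S \<in> I. i \<in> S} = {}\<close>) simp
      qed
      show "f (y, i) = 1" if "E i = UNIV"
      proof -
        have "{S \<in> I. i \<in> S} = I" using that ij by (auto simp: I_def \<kappa>_def)
        show ?thesis
          using ij by (simp only: f_def fst_conv snd_conv \<open>{S \<in> I. i \<in> S} = I\<close> w(3) if_True)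
      qed
    qed
    moreover have "norm (b f i - m i) \<le> 1 / Suc n" if "i < n" for i
    proof -
      let ?T = "{S \<in> I. i \<in> S}"
      have w1: "w S y \<le> 1" if "S \<in> I" for S y
        using member_le_sum[of S I "\<lambda>S. w S y"] that I w by auto
      have intw: "integrable \<nu> (\<lambda>y. w S y *\<^sub>R y)" if "S \<in> I" for S
        using int[of "\<lambda>z. w S (fst z)"] w(2) w1[OF that] by simp
      have int\<kappa>: "integrable \<mu> (\<lambda>x. indicator (\<kappa> -` {S}) x *\<^sub>R x)" if "S \<in> I" for S
        using M1_D(5)[OF \<mu>] \<kappa>[OF that] by (intro integrable_mult_indicator) (simp_all add: M1_D(1)[OF \<mu>])
      have "b f i = (LINT y|\<nu>. (\<Sum>S\<in>?T. w S y *\<^sub>R y))"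
        using that by (simp add: b_def f_def scaleR_sum_left)
      also have "\<dots> = (\<Sum>S\<in>?T. LINT y|\<nu>. w S y *\<^sub>R y)"
        by (rule Bochner_Integration.integral_sum) (use intw in auto)
      finally have bf: "b f i = (\<Sum>S\<in>?T. LINT y|\<nu>. w S y *\<^sub>R y)" .
      have ind: "indicator (E i) x *\<^sub>R x = (\<Sum>S\<in>?T. indicator (\<kappa> -` {S}) x *\<^sub>R x)" for x
      proof -
        have "(\<Sum>S\<in>?T. indicator (\<kappa> -` {S}) x *\<^sub>R x) = (\<Sum>S\<in>?T \<inter> {\<kappa> x}. indicator (\<kappa> -` {S}) x *\<^sub>R x)"
          using I by (intro sum.mono_neutral_right) (auto simp: indicator_def)
        also have "?T \<inter> {\<kappa> x} = (if x \<in> E i then {\<kappa> x} else {})"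
          using that by (auto simp: I_def \<kappa>_def)
        finally show ?thesis by (simp add: indicator_def)
      qed
      have "m i = (\<Sum>S\<in>?T. LINT x|\<mu>. indicator (\<kappa> -` {S}) x *\<^sub>R x)"
        unfolding m_def ind by (rule Bochner_Integration.integral_sum) (use int\<kappa> in auto)
      then have "norm (b f i - m i) \<le> (\<Sum>S\<in>?T. \<epsilon>)"
        unfolding bf by (simp only: sum_subtractf[symmetric]) (rule sum_norm_le, use wm in \<open>auto intro: less_imp_le\<close>)
      also have "\<dots> \<le> (\<Sum>S\<in>I. \<epsilon>)"
        using I \<open>0 < \<epsilon>\<close> by (intro sum_mono2) auto
      also have "\<dots> = 1 / Suc n"
        using I0 by (simp add: \<epsilon>_def del: of_nat_Suc)
      finally show ?thesis .
    qed
    ultimately have "f \<in> C n"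
      using f01 fm by (simp add: C_def)
    then show ?thesis by blast
  qed
  have "(\<Inter>n. C n) \<noteq> {}"
  proof (rule nested_convex_Inter_nonempty[OF fin nonempty])
    show "C (Suc n) \<subseteq> C n" for n
    proof
      fix f assume f: "f \<in> C (Suc n)"
      have "1 / Suc (Suc n) \<le> (1 / Suc n :: real)" by (simp add: frac_le)
      moreover have "norm (b f i - m i) \<le> 1 / Suc (Suc n)" if "i < n" for i
        using f that by (simp add: C_def)
      ultimately have "norm (b f i - m i) \<le> 1 / Suc n" if "i < n" for i
        using that by (meson order_trans)
      moreover have "AE y in \<nu>. admissible n (\<lambda>i. f (y, i))"
      proof -
        have "AE y in \<nu>. admissible (Suc n) (\<lambda>i. f (y, i))"
          using f by (simp add: C_def)
        then show ?thesis
        proof eventually_elim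
          fix y assume "admissible (Suc n) (\<lambda>i. f (y, i))"
          then show "admissible n (\<lambda>i. f (y, i))"
            unfolding admissible_def by (meson less_SucI)
        qed
      qed
      ultimately show "f \<in> C n" using f by (simp add: C_def)
    qed
    show "f \<in> borel_measurable (\<nu> \<Otimes>\<^sub>M K)" "0 \<le> f z \<and> f z \<le> 1" if "f \<in> C n" for n f z
      using that unfolding C_def by blast+
    show "(\<lambda>z. (f z + h z) / 2) \<in> C n" if f: "f \<in> C n" and h: "h \<in> C n" for n f h
    proof -
      have fm[measurable]: "f \<in> borel_measurable (\<nu> \<Otimes>\<^sub>M K)" and f01: "\<And>z. 0 \<le> f z \<and> f z \<le> 1"
        and fa: "AE y in \<nu>. admissible n (\<lambda>i. f (y, i))" and fn: "\<And>i. i < n \<Longrightarrow> norm (b f i - m i) \<le> 1 / Suc n"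
        using f unfolding C_def by blast+
      have hm[measurable]: "h \<in> borel_measurable (\<nu> \<Otimes>\<^sub>M K)" and h01: "\<And>z. 0 \<le> h z \<and> h z \<le> 1"
        and ha: "AE y in \<nu>. admissible n (\<lambda>i. h (y, i))" and hn: "\<And>i. i < n \<Longrightarrow> norm (b h i - m i) \<le> 1 / Suc n"
        using h unfolding C_def by blast+
      have "AE y in \<nu>. admissible n (\<lambda>i. (f (y, i) + h (y, i)) / 2)"
        using fa ha by eventually_elim (auto simp: admissible_def intro!: add_mono divide_right_mono)
      moreover have "norm (b (\<lambda>z. (f z + h z) / 2) i - m i) \<le> 1 / Suc n" if "i < n" for i
      proof -
        have "b (\<lambda>z. (f z + h z) / 2) i = (LINT y|\<nu>. (1 / 2) *\<^sub>R (f (y, i) *\<^sub>R y) + (1 / 2) *\<^sub>R (h (y, i) *\<^sub>R y))"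
          by (simp add: b_def scaleR_add_left add_divide_distrib)
        also have "\<dots> = (1 / 2) *\<^sub>R b f i + (1 / 2) *\<^sub>R b h i"
          unfolding b_def by (rule integral_linear_combination[OF int[OF fm f01] int[OF hm h01]])
        finally have "b (\<lambda>z. (f z + h z) / 2) i = (1 / 2) *\<^sub>R b f i + (1 / 2) *\<^sub>R b h i" .
        moreover have "m i = (1 / 2) *\<^sub>R m i + (1 / 2) *\<^sub>R m i" by (simp flip: scaleR_add_left)
        ultimately have "b (\<lambda>z. (f z + h z) / 2) i - m i = (1 / 2) *\<^sub>R (b f i - m i) + (1 / 2) *\<^sub>R (b h i - m i)"
          by (simp add: algebra_simps)
        then have "norm (b (\<lambda>z. (f z + h z) / 2) i - m i) \<le> (1 / 2) * norm (b f i - m i) + (1 / 2) * norm (b h i - m i)"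
          using norm_triangle_ineq[of "(1 / 2) *\<^sub>R (b f i - m i)" "(1 / 2) *\<^sub>R (b h i - m i)"] by simp
        then show ?thesis using fn[OF that] hn[OF that] by linarith
      qed
      moreover have "0 \<le> (f z + h z) / 2 \<and> (f z + h z) / 2 \<le> 1" for z
        using f01[of z] h01[of z] by simp
      ultimately show ?thesis by (simp add: C_def)
    qed
    show "f \<in> C n" if F: "\<And>k. F k \<in> C n" and fm: "f \<in> borel_measurable (\<nu> \<Otimes>\<^sub>M K)"
      and f01: "\<And>z. 0 \<le> f z \<and> f z \<le> 1" and lim: "AE z in \<nu> \<Otimes>\<^sub>M K. (\<lambda>k. F k z) \<longlonglongrightarrow> f z" for n F f
    proof -
      have Fm: "F k \<in> borel_measurable (\<nu> \<Otimes>\<^sub>M K)" and F01: "\<And>z. 0 \<le> F k z \<and> F k z \<le> 1"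
        and Fa: "AE y in \<nu>. admissible n (\<lambda>i. F k (y, i))"
        and Fn: "\<And>i. i < n \<Longrightarrow> norm (b (F k) i - m i) \<le> 1 / Suc n" for k
        using F[of k] unfolding C_def by blast+
      have lim': "AE y in \<nu>. \<forall>i. (\<lambda>k. F k (y, i)) \<longlonglongrightarrow> f (y, i)"
        using P.AE_pair[OF lim] unfolding K_AE .
      have "AE y in \<nu>. \<forall>k. admissible n (\<lambda>i. F k (y, i))"
        using Fa by (simp add: AE_all_countable)
      with lim' have "AE y in \<nu>. admissible n (\<lambda>i. f (y, i))"
      proof eventually_elim
        fix y assume l: "\<forall>i. (\<lambda>k. F k (y, i)) \<longlonglongrightarrow> f (y, i)" and a: "\<forall>k. admissible n (\<lambda>i. F k (y, i))"
        show "admissible n (\<lambda>i. f (y, i))"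
          unfolding admissible_def
        proof (intro allI impI conjI)
          fix i j assume ij: "i < n" "j < n"
          show "f (y, i) \<le> f (y, j)" if "E i \<subseteq> E j"
            by (rule LIMSEQ_le[OF l[rule_format] l[rule_format]]) (use a ij that in \<open>auto simp: admissible_def\<close>)
          show "f (y, i) = 0" if "E i = {}"
          proof -
            have eq: "(\<lambda>k. F k (y, i)) = (\<lambda>k. 0)" using a ij that by (auto simp: admissible_def)
            show ?thesis by (rule LIMSEQ_unique[OF l[rule_format, of i, unfolded eq] tendsto_const])
          qed
          show "f (y, i) = 1" if "E i = UNIV"
          proof -
            have eq: "(\<lambda>k. F k (y, i)) = (\<lambda>k. 1)" using a ij that by (auto simp: admissible_def)
            show ?thesis by (rule LIMSEQ_unique[OF l[rule_format, of i, unfolded eq] tendsto_const])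
          qed
        qed
      qed
      moreover have "norm (b f i - m i) \<le> 1 / Suc n" if "i < n" for i
      proof -
        note [measurable] = sec[OF fm] sec[OF Fm]
        have "(\<lambda>k. b (F k) i) \<longlonglongrightarrow> b f i"
          unfolding b_def
        proof (rule integral_dominated_convergence)
          show "integrable \<nu> norm" by (rule M1_D(4)[OF \<nu>])
          show "AE y in \<nu>. (\<lambda>k. F k (y, i) *\<^sub>R y) \<longlonglongrightarrow> f (y, i) *\<^sub>R y"
            using lim' by eventually_elim (intro tendsto_intros, simp)
          show "AE y in \<nu>. norm (F k (y, i) *\<^sub>R y) \<le> norm y" for k
            using F01[of k] by (auto intro!: mult_left_le_one_le)
        qed measurable
        then have "(\<lambda>k. norm (b (F k) i - m i)) \<longlonglongrightarrow> norm (b f i - m i)"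
          by (intro tendsto_intros)
        then show ?thesis
          by (rule LIMSEQ_le_const2) (use Fn[OF that] in auto)
      qed
      ultimately show ?thesis using fm f01 by (simp add: C_def)
    qed
  qed
  then obtain f where f: "\<And>n. f \<in> C n" by blast
  show ?thesis
  proof (rule that[of "\<lambda>i y. f (y, i)"])
    show "(\<lambda>y. f (y, i)) \<in> borel_measurable \<nu>" for i
      using f[of 0] by (intro sec) (simp add: C_def)
    have "AE y in \<nu>. \<forall>n. admissible n (\<lambda>i. f (y, i))"
      using f by (simp add: AE_all_countable C_def)
    then have all: "AE y in \<nu>. \<forall>i j. (E i \<subseteq> E j \<longrightarrow> f (y, i) \<le> f (y, j)) \<and>
      (E i = {} \<longrightarrow> f (y, i) = 0) \<and> (E i = UNIV \<longrightarrow> f (y, i) = 1)"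
    proof eventually_elim
      fix y assume a: "\<forall>n. admissible n (\<lambda>i. f (y, i))"
      show "\<forall>i j. (E i \<subseteq> E j \<longrightarrow> f (y, i) \<le> f (y, j)) \<and>
        (E i = {} \<longrightarrow> f (y, i) = 0) \<and> (E i = UNIV \<longrightarrow> f (y, i) = 1)"
      proof (intro allI)
        fix i j
        show "(E i \<subseteq> E j \<longrightarrow> f (y, i) \<le> f (y, j)) \<and>
          (E i = {} \<longrightarrow> f (y, i) = 0) \<and> (E i = UNIV \<longrightarrow> f (y, i) = 1)"
          using a[rule_format, of "Suc (max i j)"] unfolding admissible_def
          by (meson le_imp_less_Suc max.cobounded1 max.cobounded2)
      qed
    qed
    show "AE y in \<nu>. \<forall>i j. E i \<subseteq> E j \<longrightarrow> f (y, i) \<le> f (y, j)"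
      "AE y in \<nu>. \<forall>i. E i = {} \<longrightarrow> f (y, i) = 0" "AE y in \<nu>. \<forall>i. E i = UNIV \<longrightarrow> f (y, i) = 1"
      using all by (eventually_elim, blast)+
    show "(LINT y|\<nu>. f (y, i) *\<^sub>R y) = (LINT x|\<mu>. indicator (E i) x *\<^sub>R x)" for i
    proof -
      have "norm (b f i - m i) \<le> inverse (real (Suc n))" if "Suc i \<le> n" for n
        using f[of n] that by (simp add: C_def inverse_eq_divide)
      then have "norm (b f i - m i) \<le> 0"
        by (intro LIMSEQ_le_const[OF LIMSEQ_inverse_real_of_nat]) blast
      then show ?thesis by (simp add: b_def m_def)
    qed
  qed
qed

text \<open>
  The sets \<open>E i\<close> are the half lines with rational endpoints in the coding of the space by the unit
  interval, so \<open>W\<close> consists of distribution functions.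
\<close>
lemma moment_kernel_to_source:
  fixes \<mu> \<nu> :: "(real ^ 'n) measure"
  assumes \<mu>: "\<mu> \<in> M1" and \<nu>: "\<nu> \<in> M1" and le: "\<mu> \<preceq>\<^sub>s \<nu>"
  obtains r where "r \<in> borel \<rightarrow>\<^sub>M prob_algebra borel"
    "\<And>A. A \<in> sets borel \<Longrightarrow> (LINT y|\<nu>. measure (r y) A *\<^sub>R y) = (LINT x|\<mu>. indicator A x *\<^sub>R x)"
proof -
  obtain c :: "real ^ 'n \<Rightarrow> real" and g where c[measurable]: "c \<in> borel_measurable borel"
    and g: "g \<in> borel_measurable borel" "\<And>x. g (c x) = x" and c01: "\<And>x. 0 \<le> c x" "\<And>x. c x \<le> 1"
    using borel_code_unit_interval by metis
  define E where "E i = {x. c x \<le> of_rat (from_nat i)}" for i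
  have [measurable]: "E i \<in> sets borel" for i
    unfolding E_def by measurable
  obtain W where W: "\<And>i. W i \<in> borel_measurable \<nu>"
    "AE y in \<nu>. \<forall>i j. E i \<subseteq> E j \<longrightarrow> W i y \<le> W j y"
    "AE y in \<nu>. \<forall>i. E i = {} \<longrightarrow> W i y = 0"
    "AE y in \<nu>. \<forall>i. E i = UNIV \<longrightarrow> W i y = 1"
    and Wm: "\<And>i. (LINT y|\<nu>. W i y *\<^sub>R y) = (LINT x|\<mu>. indicator (E i) x *\<^sub>R x)"
    using fractional_sets_with_prescribed_moments[OF \<mu> \<nu> le, of E] by auto
  have sub: "E (to_nat q) \<subseteq> E (to_nat s)" if "q \<le> s" for q s :: rat
    using that by (auto simp: E_def intro: order_trans simp: of_rat_less_eq)
  have emp: "E (to_nat q) = {}" if "q < 0" for q :: rat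
  proof -
    have "real_of_rat q < c x" for x using that c01(1)[of x] by (simp add: less_le_trans[of _ 0])
    then show ?thesis by (auto simp: E_def not_le)
  qed
  have full: "E (to_nat q) = UNIV" if "1 \<le> q" for q :: rat
  proof -
    have "c x \<le> real_of_rat q" for x using that c01(2)[of x] by (simp add: order_trans[of _ 1])
    then show ?thesis by (auto simp: E_def)
  qed
  have "AE y in \<nu>. \<forall>(q::rat) s. q \<le> s \<longrightarrow> W (to_nat q) y \<le> W (to_nat s) y"
    using W(2) by eventually_elim (simp add: sub)
  moreover have "AE y in \<nu>. \<forall>q<0. W (to_nat (q::rat)) y = 0"
    using W(3) by eventually_elim (simp add: emp)
  moreover have "AE y in \<nu>. \<forall>q\<ge>1. W (to_nat (q::rat)) y = 1"
    using W(4) by eventually_elim (simp add: full)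
  ultimately obtain r where r: "r \<in> \<nu> \<rightarrow>\<^sub>M prob_algebra borel"
    "\<And>\<phi> :: real ^ 'n \<Rightarrow> real ^ 'n. \<And>\<Theta> \<psi>. integrable \<nu> \<phi> \<Longrightarrow> sets \<Theta> = sets borel \<Longrightarrow> integrable \<Theta> \<psi> \<Longrightarrow>
      (\<And>q. (LINT x|\<nu>. W (to_nat q) x *\<^sub>R \<phi> x) = (LINT y|\<Theta>. indicator {y. c y \<le> of_rat q} y *\<^sub>R \<psi> y)) \<Longrightarrow>
      (\<forall>E \<in> sets borel. (LINT x|\<nu>. measure (r x) E *\<^sub>R \<phi> x) = (LINT y|\<Theta>. indicator E y *\<^sub>R \<psi> y))"
    using kernel_of_distribution_functions[OF c g c01(2) W(1), where 'e = "real ^ 'n"] by blast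
  have "(LINT y|\<nu>. W (to_nat q) y *\<^sub>R y) = (LINT x|\<mu>. indicator {y. c y \<le> of_rat q} x *\<^sub>R x)" for q
    unfolding Wm by (simp add: E_def)
  from r(2)[OF M1_D(5)[OF \<nu>] M1_D(1)[OF \<mu>] M1_D(5)[OF \<mu>] this] r(1)
  show ?thesis
    using that[of r] by (simp add: measurable_cong_sets[OF M1_D(1)[OF \<nu>] refl])
qed

section \<open>Absolute continuity and reversal of the kernel\<close>

text \<open>
  The part of the Lebesgue decomposition needed here: exhausting \<open>\<rho>\<close> by \<open>\<mu>\<close>-null sets gives one
  that carries the whole singular part of \<open>\<rho>\<close>.
\<close>
lemma maximal_null_set:
  assumes "finite_measure \<rho>" and sets: "sets \<rho> = sets \<mu>"
  obtains Z where "Z \<in> null_sets \<mu>" "\<And>A. A \<in> null_sets \<mu> \<Longrightarrow> emeasure \<rho> (A - Z) = 0"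
proof -
  interpret finite_measure \<rho> by fact
  define s where "s = Sup (measure \<rho> ` null_sets \<mu>)"
  have bdd: "bdd_above (measure \<rho> ` null_sets \<mu>)"
    by (auto intro!: bdd_aboveI[of _ "measure \<rho> (space \<rho>)"] bounded_measure)
  have le_s: "measure \<rho> A \<le> s" if "A \<in> null_sets \<mu>" for A
    unfolding s_def using that by (intro cSup_upper[OF _ bdd]) auto
  have "\<exists>A\<in>null_sets \<mu>. s - 1 / Suc n < measure \<rho> A" for n
  proof -
    have "s - 1 / Suc n < s" by simp
    then show ?thesis
      unfolding s_def by (subst (asm) less_cSup_iff[OF _ bdd]) auto
  qed
  then obtain X where X: "\<And>n. X n \<in> null_sets \<mu>" "\<And>n. s - 1 / Suc n < measure \<rho> (X n)" by metis
  define Z where "Z = (\<Union>n. X n)"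
  have Z: "Z \<in> null_sets \<mu>" unfolding Z_def using X(1) by auto
  then have Zs: "Z \<in> sets \<rho>" using sets by auto
  have "s \<le> measure \<rho> Z"
  proof (rule field_le_epsilon)
    fix e :: real assume "0 < e"
    then obtain n where "1 / Suc n < e" using nat_approx_posE by blast
    moreover have "measure \<rho> (X n) \<le> measure \<rho> Z"
      using Zs by (intro finite_measure_mono) (auto simp: Z_def)
    ultimately show "s \<le> measure \<rho> Z + e" using X(2)[of n] by linarith
  qed
  show ?thesis
  proof (rule that[OF Z])
    fix A assume A: "A \<in> null_sets \<mu>"
    then have As: "A \<in> sets \<rho>" using sets by auto
    have "measure \<rho> Z + measure \<rho> (A - Z) = measure \<rho> (Z \<union> (A - Z))"
      using As Zs by (intro finite_measure_Union[symmetric]) auto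
    also have "\<dots> = measure \<rho> (A \<union> Z)" by (rule arg_cong[of _ _ "measure \<rho>"]) auto
    also have "\<dots> \<le> s" using A Z by (intro le_s) auto
    finally have "measure \<rho> (A - Z) \<le> 0" using \<open>s \<le> measure \<rho> Z\<close> by simp
    then show "emeasure \<rho> (A - Z) = 0"
      by (simp add: emeasure_eq_measure measure_le_0_iff)
  qed
qed

text \<open>
  Mass that the kernel sends into the singular set \<open>Z\<close> is redirected to a point chosen according to
  \<open>\<mu>\<close>, normalized. Its total contribution to the moments is \<open>\<integral>\<^bsub>Z\<^esub> x \<mu>(dx) = 0\<close>, so the moment
  identity survives.
\<close>
lemma moment_kernel_abs_continuous:
  fixes \<mu> \<nu> :: "(real ^ 'n) measure"
  assumes \<mu>: "\<mu> \<in> M1" and \<nu>: "\<nu> \<in> M1" and le: "\<mu> \<preceq>\<^sub>s \<nu>" and nz: "emeasure \<mu> UNIV \<noteq> 0"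
  obtains r where "r \<in> borel \<rightarrow>\<^sub>M prob_algebra borel"
    "\<And>A. A \<in> sets borel \<Longrightarrow> (LINT y|\<nu>. measure (r y) A *\<^sub>R y) = (LINT x|\<mu>. indicator A x *\<^sub>R x)"
    "\<And>A. A \<in> null_sets \<mu> \<Longrightarrow> (\<integral>\<^sup>+y. emeasure (r y) A \<partial>\<nu>) = 0"
proof -
  note [measurable_cong] = M1_D(1)[OF \<mu>] M1_D(1)[OF \<nu>]
  note sets_\<mu> = M1_D(1)[OF \<mu>] and sets_\<nu> = M1_D(1)[OF \<nu>]
  interpret \<mu>: finite_measure \<mu> by (rule M1_D(2)[OF \<mu>])
  interpret \<nu>: finite_measure \<nu> by (rule M1_D(2)[OF \<nu>])
  obtain r where r[measurable]: "r \<in> borel \<rightarrow>\<^sub>M prob_algebra borel"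
    and rm: "\<And>A. A \<in> sets borel \<Longrightarrow> (LINT y|\<nu>. measure (r y) A *\<^sub>R y) = (LINT x|\<mu>. indicator A x *\<^sub>R x)"
    using moment_kernel_to_source[OF \<mu> \<nu> le] by blast
  have r\<nu>: "r \<in> \<nu> \<rightarrow>\<^sub>M subprob_algebra borel"
    using measurable_prob_algebraD[OF r] by (simp add: measurable_cong_sets[OF sets_\<nu> refl])
  have r_prob: "prob_space (r y)" and r_sets: "sets (r y) = sets borel" for y
    using measurable_space[OF r, of y] by (auto simp: space_prob_algebra)
  define \<rho> where "\<rho> = \<nu> \<bind> r"
  have em_\<rho>: "emeasure \<rho> A = (\<integral>\<^sup>+y. emeasure (r y) A \<partial>\<nu>)" if "A \<in> sets borel" for A
    unfolding \<rho>_def by (rule emeasure_bind[OF _ r\<nu> that]) (simp add: M1_D(3)[OF \<nu>])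
  have sets_\<rho>: "sets \<rho> = sets borel"
    unfolding \<rho>_def by (rule sets_bind) (auto simp: r_sets M1_D(3)[OF \<nu>])
  have "finite_measure \<rho>"
  proof (rule finite_measureI)
    have "emeasure (r y) UNIV = 1" for y
      using prob_space.emeasure_space_1[OF r_prob[of y]] sets_eq_imp_space_eq[OF r_sets[of y]] by simp
    then have "emeasure \<rho> UNIV = emeasure \<nu> (space \<nu>)"
      by (simp add: em_\<rho>)
    then show "emeasure \<rho> (space \<rho>) \<noteq> \<infinity>"
      using sets_eq_imp_space_eq[OF sets_\<rho>] \<nu>.emeasure_finite by simp
  qed
  then obtain Z where Z: "Z \<in> null_sets \<mu>" "\<And>A. A \<in> null_sets \<mu> \<Longrightarrow> emeasure \<rho> (A - Z) = 0"
    using maximal_null_set[of \<rho> \<mu>] sets_\<rho> sets_\<mu> by metis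
  have Zs[measurable]: "Z \<in> sets borel" using Z(1) sets_\<mu> by auto
  define P where "P = density \<mu> (\<lambda>_. inverse (emeasure \<mu> UNIV))"
  have P_em: "emeasure P A = inverse (emeasure \<mu> UNIV) * emeasure \<mu> A" if "A \<in> sets borel" for A
    unfolding P_def using that by (intro emeasure_density_const) (simp add: sets_\<mu>)
  have fin: "emeasure \<mu> UNIV < \<top>" by (metis less_top \<mu>.emeasure_finite infinity_ennreal_def)
  have "prob_space P"
  proof (rule prob_spaceI)
    show "emeasure P (space P) = 1"
      using P_em[of UNIV] nz fin
      by (simp add: P_def M1_D(3)[OF \<mu>] ennreal_divide_self mult.commute[of "inverse _"] flip: divide_ennreal_def)
  qed
  then have P_in: "P \<in> space (prob_algebra borel)"
    by (auto simp: space_prob_algebra P_def sets_\<mu>)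
  interpret P: prob_space P by fact
  define h where "h x = (if x \<in> Z then P else return borel x)" for x
  have h[measurable]: "h \<in> borel \<rightarrow>\<^sub>M prob_algebra borel"
    unfolding h_def[abs_def]
    by (rule measurable_If) (auto simp: P_in measurable_return_prob_space)
  define r' where "r' y = r y \<bind> h" for y
  have r'[measurable]: "r' \<in> borel \<rightarrow>\<^sub>M prob_algebra borel"
    unfolding r'_def[abs_def] by (rule measurable_bind_prob_space[OF r h])
  have em_r': "emeasure (r' y) A = emeasure (r y) (A - Z) + emeasure P A * emeasure (r y) Z"
    if A[measurable]: "A \<in> sets borel" for y A
  proof -
    have "emeasure (r' y) A = (\<integral>\<^sup>+x. emeasure (h x) A \<partial>r y)"
      unfolding r'_def using measurable_space[OF r, of y] by (intro emeasure_bind_prob_algebra[OF _ h A]) auto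
    also have "\<dots> = (\<integral>\<^sup>+x. indicator (A - Z) x + emeasure P A * indicator Z x \<partial>r y)"
      by (intro nn_integral_cong) (auto simp: h_def indicator_def)
    also have "\<dots> = emeasure (r y) (A - Z) + emeasure P A * emeasure (r y) Z"
      using A Zs by (subst nn_integral_add) (auto simp: nn_integral_cmult r_sets measurable_cong_sets[OF r_sets refl])
    finally show ?thesis .
  qed
  have m_r': "measure (r' y) A = measure (r y) (A - Z) + measure P A * measure (r y) Z"
    if A: "A \<in> sets borel" for y A
  proof -
    interpret R: prob_space "r y" by (rule r_prob)
    show ?thesis
      using em_r'[OF A, of y] unfolding measure_def
      by (simp add: enn2real_plus enn2real_mult R.emeasure_eq_measure P.emeasure_eq_measure ennreal_mult_less_top)
  qed
  have int: "integrable \<nu> (\<lambda>y. measure (r y) A *\<^sub>R y)" if [measurable]: "A \<in> sets borel" for A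
    using prob_space.prob_le_1[OF r_prob]
    by (intro Bochner_Integration.integrable_bound[OF M1_D(4)[OF \<nu>]]) (auto intro!: AE_I2 mult_left_le_one_le)
  show ?thesis
  proof (rule that[OF r'])
    fix A :: "(real ^ 'n) set" assume A[measurable]: "A \<in> sets borel"
    have "(LINT y|\<nu>. measure (r' y) A *\<^sub>R y)
        = (LINT y|\<nu>. 1 *\<^sub>R (measure (r y) (A - Z) *\<^sub>R y) + measure P A *\<^sub>R (measure (r y) Z *\<^sub>R y))"
      by (simp add: m_r'[OF A] scaleR_add_left)
    also have "\<dots> = 1 *\<^sub>R (LINT x|\<mu>. indicator (A - Z) x *\<^sub>R x) + measure P A *\<^sub>R (LINT x|\<mu>. indicator Z x *\<^sub>R x)"
      by (subst integral_linear_combination[OF int int]) (simp_all add: rm)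
    also have "(LINT x|\<mu>. indicator Z x *\<^sub>R x) = (LINT x|\<mu>. 0)"
      using AE_not_in[OF Z(1)] by (intro integral_cong_AE) (auto elim!: AE_mp)
    also have "(LINT x|\<mu>. indicator (A - Z) x *\<^sub>R x) = (LINT x|\<mu>. indicator A x *\<^sub>R x)"
      using AE_not_in[OF Z(1)] by (intro integral_cong_AE) (auto elim!: AE_mp simp: indicator_def)
    finally show "(LINT y|\<nu>. measure (r' y) A *\<^sub>R y) = (LINT x|\<mu>. indicator A x *\<^sub>R x)"
      by simp
  next
    fix A assume A: "A \<in> null_sets \<mu>"
    then have [measurable]: "A \<in> sets borel" using sets_\<mu> by auto
    have "emeasure P A = 0" using A P_em[of A] by auto
    then have "(\<integral>\<^sup>+y. emeasure (r' y) A \<partial>\<nu>) = emeasure \<rho> (A - Z)"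
      by (simp add: em_r' em_\<rho>)
    then show "(\<integral>\<^sup>+y. emeasure (r' y) A \<partial>\<nu>) = 0"
      using Z(2)[OF A] by simp
  qed
qed

text \<open>
  Disintegration of the coupling \<open>r\<^sup>y(dx) \<nu>(dy)\<close> with respect to \<open>\<mu>\<close> in its first
  component. The density \<open>f B\<close> of the mass that comes from \<open>y \<in> B\<close> is the candidate for \<open>q\<^sup>x(B)\<close>.
  The densities for half lines \<open>B\<close>, divided by the total density \<open>H\<close>, are distribution functions of
  a probability kernel; multiplying it by \<open>H\<close> gives \<open>q\<close>, whose masses need not be bounded.
\<close>
lemma reverse_kernel:
  fixes \<mu> \<nu> :: "(real ^ 'n) measure"
  assumes "finite_measure \<mu>" "finite_measure \<nu>"
    and sets_\<mu>[measurable_cong]: "sets \<mu> = sets borel" and sets_\<nu>[measurable_cong]: "sets \<nu> = sets borel"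
    and r[measurable]: "r \<in> borel \<rightarrow>\<^sub>M prob_algebra borel"
    and null: "\<And>A. A \<in> null_sets \<mu> \<Longrightarrow> (\<integral>\<^sup>+y. emeasure (r y) A \<partial>\<nu>) = 0"
  obtains q where "unnormalized_kernel q"
    "\<And>A B. A \<in> sets borel \<Longrightarrow> B \<in> sets borel \<Longrightarrow>
      (\<integral>\<^sup>+x. emeasure (q x) B * indicator A x \<partial>\<mu>) = (\<integral>\<^sup>+y. emeasure (r y) A * indicator B y \<partial>\<nu>)"
proof -
  interpret \<mu>: finite_measure \<mu> by fact
  interpret \<nu>: finite_measure \<nu> by fact
  have sp_\<mu>: "space \<mu> = UNIV" and sp_\<nu>: "space \<nu> = UNIV"
    using sets_eq_imp_space_eq[OF sets_\<mu>] sets_eq_imp_space_eq[OF sets_\<nu>] by auto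
  have r_prob: "prob_space (r y)" and r_sets: "sets (r y) = sets borel" for y
    using measurable_space[OF r, of y] by (auto simp: space_prob_algebra)
  have r_1: "emeasure (r y) UNIV = 1" for y
    using prob_space.emeasure_space_1[OF r_prob[of y]] sets_eq_imp_space_eq[OF r_sets[of y]] by simp
  have r_em: "emeasure (r y) A = ennreal (measure (r y) A)" for y A
    using r_prob[of y] by (simp add: prob_space_def finite_measure.emeasure_eq_measure)
  have r_meas[measurable]: "(\<lambda>y. emeasure (r y) A) \<in> borel_measurable \<nu>"
    "(\<lambda>y. measure (r y) A) \<in> borel_measurable \<nu>" if "A \<in> sets borel" for A
    using measurable_compose[OF measurable_prob_algebraD[OF r] measurable_emeasure_subprob_algebra[OF that]]
      measurable_compose[OF measurable_prob_algebraD[OF r] measurable_measure_subprob_algebra[OF that]]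
    by (simp_all add: measurable_cong_sets[OF sets_\<nu> refl])
  obtain c :: "real ^ 'n \<Rightarrow> real" and g where c[measurable]: "c \<in> borel_measurable borel"
    and g: "g \<in> borel_measurable borel" "\<And>x. g (c x) = x" and c01: "\<And>x. 0 \<le> c x" "\<And>x. c x \<le> 1"
    using borel_code_unit_interval by metis
  have ex: "\<exists>f. f \<in> borel_measurable \<mu> \<and> (\<forall>A \<in> sets borel.
    (\<integral>\<^sup>+x. f x * indicator A x \<partial>\<mu>) = (\<integral>\<^sup>+y. emeasure (r y) A * indicator B y \<partial>\<nu>))"
    if B[measurable]: "B \<in> sets borel" for B
  proof -
    define \<beta> where "\<beta> = density \<nu> (indicator B) \<bind> r"
    have em: "emeasure \<beta> A = (\<integral>\<^sup>+y. emeasure (r y) A * indicator B y \<partial>\<nu>)" if A[measurable]: "A \<in> sets borel" for A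
    proof -
      have "emeasure \<beta> A = (\<integral>\<^sup>+y. emeasure (r y) A \<partial>density \<nu> (indicator B))"
        unfolding \<beta>_def using measurable_prob_algebraD[OF r]
        by (intro emeasure_bind[OF _ _ A]) (auto simp: sp_\<nu> measurable_cong_sets[OF sets_\<nu> refl])
      also have "\<dots> = (\<integral>\<^sup>+y. emeasure (r y) A * indicator B y \<partial>\<nu>)"
        by (subst nn_integral_density) (auto simp: mult.commute intro!: borel_measurable_indicator)
      finally show ?thesis .
    qed
    have sets_\<beta>: "sets \<beta> = sets \<mu>"
      unfolding \<beta>_def sets_\<mu> by (rule sets_bind) (auto simp: r_sets sp_\<nu>)
    have "finite_measure \<beta>"
    proof (rule finite_measureI)
      have "emeasure \<beta> (space \<beta>) = (\<integral>\<^sup>+y. indicator B y \<partial>\<nu>)"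
        using sets_eq_imp_space_eq[OF sets_\<beta>] by (simp add: sp_\<mu> em r_1)
      also have "\<dots> = emeasure \<nu> B" by (rule nn_integral_indicator) (simp add: sets_\<nu>)
      finally show "emeasure \<beta> (space \<beta>) \<noteq> \<infinity>" using \<nu>.emeasure_finite by simp
    qed
    moreover have "absolutely_continuous \<mu> \<beta>"
      unfolding absolutely_continuous_def
    proof
      fix A assume A: "A \<in> null_sets \<mu>"
      then have [measurable]: "A \<in> sets borel" using sets_\<mu> by auto
      have "emeasure \<beta> A \<le> (\<integral>\<^sup>+y. emeasure (r y) A \<partial>\<nu>)"
        unfolding em[OF \<open>A \<in> sets borel\<close>] by (intro nn_integral_mono) (auto simp: indicator_def)
      then show "A \<in> null_sets \<beta>"
        using null[OF A] A sets_\<beta> by (auto intro!: null_setsI)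
    qed
    ultimately obtain f where f: "f \<in> borel_measurable \<mu>" "density \<mu> f = \<beta>"
      using \<mu>.Radon_Nikodym_finite_measure[OF _ sets_\<beta>] by auto
    have "(\<integral>\<^sup>+x. f x * indicator A x \<partial>\<mu>) = emeasure \<beta> A" if "A \<in> sets borel" for A
      unfolding f(2)[symmetric] using f(1) that by (intro emeasure_density[symmetric]) (simp_all add: sets_\<mu>)
    then show ?thesis using f(1) em by (intro exI[of _ f]) simp
  qed
  define f where "f B = (SOME f. f \<in> borel_measurable \<mu> \<and> (\<forall>A \<in> sets borel.
    (\<integral>\<^sup>+x. f x * indicator A x \<partial>\<mu>) = (\<integral>\<^sup>+y. emeasure (r y) A * indicator B y \<partial>\<nu>)))" for B
  have fm: "\<And>B. B \<in> sets borel \<Longrightarrow> f B \<in> borel_measurable \<mu>"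
    and f: "\<And>A B. A \<in> sets borel \<Longrightarrow> B \<in> sets borel \<Longrightarrow>
      (\<integral>\<^sup>+x. f B x * indicator A x \<partial>\<mu>) = (\<integral>\<^sup>+y. emeasure (r y) A * indicator B y \<partial>\<nu>)"
    using someI_ex[OF ex] unfolding f_def by blast+
  note [measurable] = fm
  have f_fin: "AE x in \<mu>. f B x \<noteq> \<infinity>" if B[measurable]: "B \<in> sets borel" for B
  proof (rule nn_integral_PInf_AE)
    have "(\<integral>\<^sup>+x. f B x \<partial>\<mu>) = (\<integral>\<^sup>+y. indicator B y \<partial>\<nu>)"
      using f[of UNIV B] by (simp add: r_1)
    also have "\<dots> = emeasure \<nu> B" by (rule nn_integral_indicator) (simp add: sets_\<nu>)
    finally show "(\<integral>\<^sup>+x. f B x \<partial>\<mu>) \<noteq> \<infinity>" using \<nu>.emeasure_finite by simp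
  qed measurable
  have f_mono: "AE x in \<mu>. f B x \<le> f B' x"
    if B[measurable]: "B \<in> sets borel" "B' \<in> sets borel" and "B \<subseteq> B'" for B B'
  proof -
    \<comment> \<open>Monotonicity of densities follows from additivity, hence from uniqueness.\<close>
    have "AE x in \<mu>. f B x + f (B' - B) x = f B' x"
    proof (rule \<mu>.density_unique2)
      fix A assume "A \<in> sets \<mu>"
      then have A[measurable]: "A \<in> sets borel" using sets_\<mu> by simp
      have "(\<integral>\<^sup>+x. (f B x + f (B' - B) x) * indicator A x \<partial>\<mu>)
          = (\<integral>\<^sup>+x. f B x * indicator A x \<partial>\<mu>) + (\<integral>\<^sup>+x. f (B' - B) x * indicator A x \<partial>\<mu>)"
        by (subst nn_integral_add[symmetric]) (auto simp: distrib_right)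
      also have "\<dots> = (\<integral>\<^sup>+y. emeasure (r y) A * indicator B y + emeasure (r y) A * indicator (B' - B) y \<partial>\<nu>)"
        by (subst nn_integral_add) (auto simp: f)
      also have "\<dots> = (\<integral>\<^sup>+y. emeasure (r y) A * indicator B' y \<partial>\<nu>)"
        using \<open>B \<subseteq> B'\<close> by (intro nn_integral_cong) (auto simp: indicator_def)
      also have "\<dots> = (\<integral>\<^sup>+x. f B' x * indicator A x \<partial>\<mu>)"
        by (simp add: f)
      finally show "(\<integral>\<^sup>+x\<in>A. (f B x + f (B' - B) x) \<partial>\<mu>) = (\<integral>\<^sup>+x\<in>A. f B' x \<partial>\<mu>)" .
    qed measurable
    then show ?thesis by eventually_elim (metis le_iff_add)
  qed
  have f_empty: "AE x in \<mu>. f {} x = 0"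
    using f[of UNIV "{}"] by (simp add: nn_integral_0_iff_AE)
  define B where "B q = {y. c y \<le> real_of_rat q}" for q
  have [measurable]: "B q \<in> sets borel" for q unfolding B_def by measurable
  have B_neg: "B q = {}" if "q < 0" for q
  proof -
    have "real_of_rat q < c x" for x using that c01(1)[of x] by (simp add: less_le_trans[of _ 0])
    then show ?thesis by (auto simp: B_def not_le)
  qed
  have B_ge: "B q = UNIV" if "1 \<le> q" for q
  proof -
    have "c x \<le> real_of_rat q" for x using that c01(2)[of x] by (simp add: order_trans[of _ 1])
    then show ?thesis by (auto simp: B_def)
  qed
  define H where "H x = enn2real (f UNIV x)" for x
  \<comment> \<open>Where \<open>H\<close> vanishes, the unit mass at \<open>0\<close> serves as the normalized distribution.\<close>
  define W where "W q x = (if H x = 0 then if q < 0 then 0 else 1 else enn2real (f (B q) x) / H x)" for q x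
  have [measurable]: "H \<in> borel_measurable \<mu>"
    unfolding H_def[abs_def] by measurable
  have W_meas[measurable]: "W q \<in> borel_measurable \<mu>" for q
    unfolding W_def[abs_def] by measurable
  have H0: "0 \<le> H x" for x unfolding H_def by simp
  have AE_mono: "AE x in \<mu>. \<forall>q s. q \<le> s \<longrightarrow> f (B q) x \<le> f (B s) x"
  proof -
    have "AE x in \<mu>. q \<le> s \<longrightarrow> f (B q) x \<le> f (B s) x" for q s
    proof (cases "q \<le> s")
      case True
      then have "B q \<subseteq> B s" by (auto simp: B_def intro: order_trans simp: of_rat_less_eq)
      from f_mono[OF _ _ this] show ?thesis using True by simp
    qed simp
    then show ?thesis by (simp add: AE_all_countable)
  qed
  have AE_le: "AE x in \<mu>. \<forall>q. f (B q) x \<le> f UNIV x"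
    using f_mono[of "B _" UNIV] by (simp add: AE_all_countable)
  have fin_U: "AE x in \<mu>. f UNIV x \<noteq> \<infinity>" by (rule f_fin) simp
  have W_mono: "AE x in \<mu>. \<forall>q s. q \<le> s \<longrightarrow> W q x \<le> W s x"
    using AE_mono AE_le fin_U
  proof eventually_elim
    fix x assume 1: "\<forall>q s. q \<le> s \<longrightarrow> f (B q) x \<le> f (B s) x" and 2: "\<forall>q. f (B q) x \<le> f UNIV x"
      and 3: "f UNIV x \<noteq> \<infinity>"
    have "enn2real (f (B q) x) \<le> enn2real (f (B s) x)" if "q \<le> s" for q s
      using 1 2 3 that by (intro enn2real_mono) (auto simp: top.not_eq_extremum intro: le_less_trans)
    then show "\<forall>q s. q \<le> s \<longrightarrow> W q x \<le> W s x"
      using H0[of x] by (auto simp: W_def intro!: divide_right_mono)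
  qed
  have W_low: "AE x in \<mu>. \<forall>q<0. W q x = 0"
    using f_empty by eventually_elim (simp add: W_def B_neg)
  have W_high: "AE x in \<mu>. \<forall>q\<ge>1. W q x = 1"
    by (intro AE_I2) (auto simp: W_def B_ge H_def)
  obtain k where k: "k \<in> \<mu> \<rightarrow>\<^sub>M prob_algebra borel"
    and k_int: "\<And>\<phi> :: real ^ 'n \<Rightarrow> real. \<And>\<Theta> \<psi>. integrable \<mu> \<phi> \<Longrightarrow> sets \<Theta> = sets borel \<Longrightarrow> integrable \<Theta> \<psi> \<Longrightarrow>
      (\<And>q. (LINT x|\<mu>. W q x *\<^sub>R \<phi> x) = (LINT y|\<Theta>. indicator {y. c y \<le> of_rat q} y *\<^sub>R \<psi> y)) \<Longrightarrow>
      (\<forall>E \<in> sets borel. (LINT x|\<mu>. measure (k x) E *\<^sub>R \<phi> x) = (LINT y|\<Theta>. indicator E y *\<^sub>R \<psi> y))"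
    using kernel_of_distribution_functions[OF c g c01(2) W_meas W_mono W_low W_high, where 'e = real] by blast
  have k_prob: "prob_space (k x)" and k_sets: "sets (k x) = sets borel" for x
    using measurable_space[OF k, of x] by (auto simp: space_prob_algebra sp_\<mu>)
  note [measurable] = measurable_prob_algebraD[OF k]
  have k_em: "emeasure (k x) A = ennreal (measure (k x) A)" for x A
    using k_prob[of x] by (simp add: prob_space_def finite_measure.emeasure_eq_measure)
  have k_le1: "measure (k x) A \<le> 1" for x A
    using k_prob[of x] by (rule prob_space.prob_le_1)
  have f_int: "integrable \<mu> (\<lambda>x. enn2real (f B x))"
    and f_LINT: "A \<in> sets borel \<Longrightarrow> (LINT x|\<mu>. enn2real (f B x) * indicator A x) = (LINT y|\<nu>. indicator B y * measure (r y) A)"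
    if B[measurable]: "B \<in> sets borel" for A B
  proof -
    have fin: "AE x in \<mu>. ennreal (enn2real (f B x)) = f B x"
      using f_fin[OF B] by eventually_elim (simp add: top.not_eq_extremum)
    have "(\<integral>\<^sup>+x. ennreal (enn2real (f B x)) \<partial>\<mu>) = (\<integral>\<^sup>+x. f B x \<partial>\<mu>)"
      by (rule nn_integral_cong_AE[OF fin])
    also have "\<dots> = (\<integral>\<^sup>+y. indicator B y \<partial>\<nu>)"
      using f[of UNIV B] by (simp add: r_1)
    also have "\<dots> = emeasure \<nu> B" by (rule nn_integral_indicator) (simp add: sets_\<nu>)
    finally show "integrable \<mu> (\<lambda>x. enn2real (f B x))"
      using less_top[THEN iffD1, OF \<nu>.emeasure_finite[of B]] by (intro integrableI_nonneg) auto
    assume A[measurable]: "A \<in> sets borel"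
    have "(LINT x|\<mu>. enn2real (f B x) * indicator A x) = enn2real (\<integral>\<^sup>+x. ennreal (enn2real (f B x) * indicator A x) \<partial>\<mu>)"
      by (rule integral_eq_nn_integral) auto
    also have "(\<integral>\<^sup>+x. ennreal (enn2real (f B x) * indicator A x) \<partial>\<mu>) = (\<integral>\<^sup>+x. f B x * indicator A x \<partial>\<mu>)"
      using fin by (intro nn_integral_cong_AE) (auto simp: indicator_def elim!: AE_mp)
    also have "\<dots> = (\<integral>\<^sup>+y. ennreal (indicator B y * measure (r y) A) \<partial>\<nu>)"
      unfolding f[OF A B] by (intro nn_integral_cong) (auto simp: indicator_def r_em)
    also have "enn2real \<dots> = (LINT y|\<nu>. indicator B y * measure (r y) A)"
      by (rule integral_eq_nn_integral[symmetric]) auto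
    finally show "(LINT x|\<mu>. enn2real (f B x) * indicator A x) = (LINT y|\<nu>. indicator B y * measure (r y) A)" .
  qed
  have k_main: "(LINT x|\<mu>. measure (k x) E * (indicator A x * H x)) = (LINT y|\<nu>. indicator E y * measure (r y) A)"
    if A[measurable]: "A \<in> sets borel" and E: "E \<in> sets borel" for A E
  proof -
    have "integrable \<mu> (\<lambda>x. indicator A x * H x)"
      unfolding H_def using integrable_mult_indicator[of A \<mu>, OF _ f_int[of UNIV]] by (simp add: sets_\<mu>)
    moreover have "integrable \<nu> (\<lambda>y. measure (r y) A)"
      by (rule \<nu>.integrable_const_bound[where B = 1]) (auto simp: prob_space.prob_le_1[OF r_prob])
    moreover have "(LINT x|\<mu>. W q x *\<^sub>R (indicator A x * H x)) = (LINT y|\<nu>. indicator {y. c y \<le> of_rat q} y *\<^sub>R measure (r y) A)" for q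
    proof -
      have "AE x in \<mu>. W q x * H x = enn2real (f (B q) x)"
        using AE_le fin_U
      proof eventually_elim
        fix x assume 1: "\<forall>q. f (B q) x \<le> f UNIV x" and 2: "f UNIV x \<noteq> \<infinity>"
        show "W q x * H x = enn2real (f (B q) x)"
        proof (cases "H x = 0")
          case True
          then have "f UNIV x = 0" using 2 by (simp add: H_def enn2real_eq_0_iff)
          then show ?thesis using 1[rule_format, of q] True by simp
        qed (simp add: W_def)
      qed
      then have "(LINT x|\<mu>. W q x *\<^sub>R (indicator A x * H x)) = (LINT x|\<mu>. enn2real (f (B q) x) * indicator A x)"
        by (intro integral_cong_AE) (auto elim!: AE_mp)
      also have "\<dots> = (LINT y|\<nu>. indicator (B q) y * measure (r y) A)"
        by (rule f_LINT) simp_all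
      finally show ?thesis by (simp add: B_def)
    qed
    ultimately show ?thesis
      using k_int[of "\<lambda>x. indicator A x * H x" \<nu> "\<lambda>y. measure (r y) A"] E sets_\<nu> by simp
  qed
  define q where "q x = density (k x) (\<lambda>_. ennreal (H x))" for x
  have q_em: "emeasure (q x) E = ennreal (H x * measure (k x) E)" if "E \<in> sets borel" for x E
    unfolding q_def using that H0 by (simp add: emeasure_density_const k_sets k_em ennreal_mult)
  show ?thesis
  proof (rule that[of q])
    show "unnormalized_kernel q"
      unfolding unnormalized_kernel_def
    proof (intro conjI allI ballI)
      show q_sets: "sets (q x) = sets borel" for x by (simp add: q_def k_sets)
      show "finite_measure (q x)" for x
        by (rule finite_measureI) (simp add: sets_eq_imp_space_eq[OF q_sets] q_em)
      show "(\<lambda>x. emeasure (q x) E) \<in> borel_measurable borel" if E[measurable]: "E \<in> sets borel" for E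
      proof -
        have "(\<lambda>x. emeasure (q x) E) \<in> borel_measurable \<mu>"
          unfolding q_em[OF E] by measurable
        then show ?thesis by (simp add: measurable_cong_sets[OF sets_\<mu> refl])
      qed
    qed
    fix A E :: "(real ^ 'n) set" assume A[measurable]: "A \<in> sets borel" and E[measurable]: "E \<in> sets borel"
    have "(\<integral>\<^sup>+x. emeasure (q x) E * indicator A x \<partial>\<mu>) = (\<integral>\<^sup>+x. ennreal (measure (k x) E * (indicator A x * H x)) \<partial>\<mu>)"
      by (intro nn_integral_cong) (auto simp: q_em indicator_def mult.commute)
    also have "\<dots> = ennreal (LINT x|\<mu>. measure (k x) E * (indicator A x * H x))"
    proof (rule nn_integral_eq_integral)
      have "integrable \<mu> H" unfolding H_def[abs_def] by (rule f_int) simp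
      then show "integrable \<mu> (\<lambda>x. measure (k x) E * (indicator A x * H x))"
        by (rule Bochner_Integration.integrable_bound)
          (use H0 k_le1 in \<open>auto simp: indicator_def abs_mult intro!: AE_I2 mult_left_le_one_le\<close>)
    qed (use H0 in auto)
    also have "\<dots> = ennreal (LINT y|\<nu>. indicator E y * measure (r y) A)"
      by (simp only: k_main[OF A E])
    also have "\<dots> = (\<integral>\<^sup>+y. ennreal (indicator E y * measure (r y) A) \<partial>\<nu>)"
    proof (rule nn_integral_eq_integral[symmetric])
      show "integrable \<nu> (\<lambda>y. indicator E y * measure (r y) A)"
        by (rule \<nu>.integrable_const_bound[where B = 1])
          (auto simp: indicator_def prob_space.prob_le_1[OF r_prob])
    qed auto
    also have "\<dots> = (\<integral>\<^sup>+y. emeasure (r y) A * indicator E y \<partial>\<nu>)"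
      by (intro nn_integral_cong) (auto simp: indicator_def r_em)
    finally show "(\<integral>\<^sup>+x. emeasure (q x) E * indicator A x \<partial>\<mu>) = (\<integral>\<^sup>+y. emeasure (r y) A * indicator E y \<partial>\<nu>)" .
  qed
qed

section \<open>Existence of moment-preserving kernels\<close>

text \<open>
  The reversed kernel transports \<open>\<mu>\<close>, restricted to \<open>A\<close>, to \<open>\<nu>\<close> with density \<open>r\<^sup>y(A)\<close>. Comparing the
  integrals of a coordinate for all \<open>A\<close> gives the pointwise moment condition.
\<close>
lemma moment_preserving_kernel_of_support_le:
  fixes \<mu> \<nu> :: "(real ^ 'n) measure"
  assumes \<mu>: "\<mu> \<in> M1" and \<nu>: "\<nu> \<in> M1" and le: "\<mu> \<preceq>\<^sub>s \<nu>" and nz: "emeasure \<mu> UNIV \<noteq> 0"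
  obtains q where "q \<in> moment_preserving_kernels \<mu> \<nu>"
proof -
  note sets_\<mu> = M1_D(1)[OF \<mu>] and sets_\<nu> = M1_D(1)[OF \<nu>]
  note [measurable_cong] = sets_\<mu> sets_\<nu>
  obtain r where r: "r \<in> borel \<rightarrow>\<^sub>M prob_algebra borel"
    and r_mom: "\<And>A. A \<in> sets borel \<Longrightarrow> (LINT y|\<nu>. measure (r y) A *\<^sub>R y) = (LINT x|\<mu>. indicator A x *\<^sub>R x)"
    and r_null: "\<And>A. A \<in> null_sets \<mu> \<Longrightarrow> (\<integral>\<^sup>+y. emeasure (r y) A \<partial>\<nu>) = 0"
    using moment_kernel_abs_continuous[OF \<mu> \<nu> le nz] by blast
  have r_prob: "prob_space (r y)" and r_sets: "sets (r y) = sets borel" for y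
    using measurable_space[OF r, of y] by (auto simp: space_prob_algebra)
  have r_1: "emeasure (r y) UNIV = 1" for y
    using prob_space.emeasure_space_1[OF r_prob[of y]] sets_eq_imp_space_eq[OF r_sets[of y]] by simp
  have r_em: "emeasure (r y) A = ennreal (measure (r y) A)" for y A
    using r_prob[of y] by (simp add: prob_space_def finite_measure.emeasure_eq_measure)
  have r_meas[measurable]: "(\<lambda>y. measure (r y) A) \<in> borel_measurable \<nu>" if "A \<in> sets borel" for A
    using measurable_compose[OF measurable_prob_algebraD[OF r] measurable_measure_subprob_algebra[OF that]]
    by (simp add: measurable_cong_sets[OF sets_\<nu> refl])
  obtain q where q: "unnormalized_kernel q"
    and qr: "\<And>A B. A \<in> sets borel \<Longrightarrow> B \<in> sets borel \<Longrightarrow>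
      (\<integral>\<^sup>+x. emeasure (q x) B * indicator A x \<partial>\<mu>) = (\<integral>\<^sup>+y. emeasure (r y) A * indicator B y \<partial>\<nu>)"
    using reverse_kernel[OF M1_D(2)[OF \<mu>] M1_D(2)[OF \<nu>] sets_\<mu> sets_\<nu> r r_null] by blast
  have q_sets: "sets (q x) = sets borel" for x
    using q by (auto simp: unnormalized_kernel_def)
  have q_meas[measurable]: "(\<lambda>x. emeasure (q x) B) \<in> borel_measurable \<mu>" if "B \<in> sets borel" for B
    using q that unfolding measurable_cong_sets[OF sets_\<mu> refl] by (auto simp: unnormalized_kernel_def)
  have q_tr: "(\<integral>\<^sup>+x. emeasure (q x) B \<partial>\<mu>) = emeasure \<nu> B" if B[measurable]: "B \<in> sets borel" for B
  proof -
    have "(\<integral>\<^sup>+x. emeasure (q x) B \<partial>\<mu>) = (\<integral>\<^sup>+y. indicator B y \<partial>\<nu>)"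
      using qr[OF _ B, of UNIV] by (simp add: r_1)
    also have "\<dots> = emeasure \<nu> B" by (rule nn_integral_indicator) (simp add: sets_\<nu>)
    finally show ?thesis .
  qed
  have comp: "AE x in \<mu>. has_bochner_integral (q x) (\<lambda>y. y \<bullet> b) (x \<bullet> b)" for b
  proof -
    let ?f = "\<lambda>y :: real ^ 'n. y \<bullet> b"
    have int_\<nu>: "integrable \<nu> ?f" and int_\<mu>: "integrable \<mu> ?f"
      using M1_D(5)[OF \<nu>] M1_D(5)[OF \<mu>] by auto
    have "transports q \<mu> \<nu>"
      using q_sets sets_\<nu> q_meas q_tr by (simp add: transports_def)
    note K = integral_kernel[OF this int_\<nu>]
    have "AE x in \<mu>. kernel_integral q ?f x = x \<bullet> b"
    proof (rule density_unique_real[OF K(1) int_\<mu>])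
      fix A assume "A \<in> sets \<mu>"
      then have A[measurable]: "A \<in> sets borel" using sets_\<mu> by simp
      let ?\<mu> = "density \<mu> (\<lambda>x. ennreal (indicator A x))" and ?\<theta> = "density \<nu> (\<lambda>y. ennreal (measure (r y) A))"
      have q_tr': "(\<integral>\<^sup>+x. emeasure (q x) B \<partial>?\<mu>) = emeasure ?\<theta> B" if B[measurable]: "B \<in> sets borel" for B
      proof -
        have "(\<integral>\<^sup>+x. emeasure (q x) B \<partial>?\<mu>) = (\<integral>\<^sup>+x. emeasure (q x) B * indicator A x \<partial>\<mu>)"
          by (subst nn_integral_density) (auto simp: mult.commute ennreal_indicator)
        also have "\<dots> = (\<integral>\<^sup>+y. emeasure (r y) A * indicator B y \<partial>\<nu>)" by (rule qr[OF A B])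
        also have "\<dots> = emeasure ?\<theta> B"
          by (subst emeasure_density) (auto simp: r_em sets_\<nu>)
        finally show ?thesis .
      qed
      then have tr': "transports q ?\<mu> ?\<theta>"
        using q_sets q_meas by (simp add: transports_def sets_\<nu>)
      have int_r: "integrable \<nu> (\<lambda>y. measure (r y) A *\<^sub>R y)"
        using prob_space.prob_le_1[OF r_prob]
        by (intro Bochner_Integration.integrable_bound[OF M1_D(4)[OF \<nu>]]) (auto intro!: AE_I2 mult_left_le_one_le)
      have int_ind: "integrable \<mu> (\<lambda>x. indicator A x *\<^sub>R x)"
        by (rule integrable_mult_indicator[OF _ M1_D(5)[OF \<mu>]]) (simp add: sets_\<mu>)
      have "integrable ?\<theta> ?f"
      proof (subst integrable_density)
        show "integrable \<nu> (\<lambda>y. measure (r y) A *\<^sub>R (y \<bullet> b))"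
          using integrable_inner_left[of b \<nu>, OF int_r] by simp
      qed auto
      from integral_kernel(3)[OF tr' this]
      have "(LINT x|?\<mu>. kernel_integral q ?f x) = (LINT y|?\<theta>. y \<bullet> b)" .
      moreover have "(LINT x|?\<mu>. kernel_integral q ?f x) = (LINT x|\<mu>. indicator A x *\<^sub>R kernel_integral q ?f x)"
        using K(1) by (intro integral_density) auto
      moreover have "(LINT y|?\<theta>. y \<bullet> b) = (LINT y|\<nu>. (measure (r y) A *\<^sub>R y) \<bullet> b)"
        by (subst integral_density) auto
      moreover have "\<dots> = (LINT x|\<mu>. (indicator A x *\<^sub>R x) \<bullet> b)"
        using integral_inner_left[of b \<nu>, OF int_r] integral_inner_left[of b \<mu>, OF int_ind] r_mom[OF A] by presburger
      ultimately show "(LINT x:A|\<mu>. kernel_integral q ?f x) = (LINT x:A|\<mu>. x \<bullet> b)"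
        by (simp add: set_lebesgue_integral_def)
    qed
    with K(2) show ?thesis by eventually_elim simp
  qed
  have "AE x in \<mu>. \<forall>b\<in>Basis. has_bochner_integral (q x) (\<lambda>y. y \<bullet> b) (x \<bullet> b)"
    using comp by (intro AE_finite_allI) auto
  then have "AE x in \<mu>. has_bochner_integral (q x) (\<lambda>y. y) x"
  proof eventually_elim
    fix x assume "\<forall>b\<in>Basis. has_bochner_integral (q x) (\<lambda>y. y \<bullet> b) (x \<bullet> b)"
    then have "has_bochner_integral (q x) (\<lambda>y. \<Sum>b\<in>Basis. (y \<bullet> b) *\<^sub>R b) (\<Sum>b\<in>Basis. (x \<bullet> b) *\<^sub>R b)"
      by (intro has_bochner_integral_sum has_bochner_integral_scaleR_left) auto
    then show "has_bochner_integral (q x) (\<lambda>y. y) x"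
      by (simp add: euclidean_representation)
  qed
  then have "q \<in> moment_preserving_kernels \<mu> \<nu>"
    using q q_tr by (simp add: moment_preserving_kernels_def transport_kernels_def)
  then show ?thesis by (rule that)
qed

theorem theorem1p5:
  fixes \<mu> \<nu> :: "(real ^ 'n) measure"
  assumes "\<mu> \<in> M1" and "\<nu> \<in> M1"
    and "emeasure \<mu> UNIV \<noteq> 0 \<or> emeasure \<nu> UNIV = 0"
  shows "\<mu> \<preceq>\<^sub>s \<nu> \<longleftrightarrow> moment_preserving_kernels \<mu> \<nu> \<noteq> {}"
proof
  assume le: "\<mu> \<preceq>\<^sub>s \<nu>"
  show "moment_preserving_kernels \<mu> \<nu> \<noteq> {}"
  proof (cases "emeasure \<mu> UNIV = 0")
    case False
    then show ?thesis
      using moment_preserving_kernel_of_support_le[OF assms(1,2) le] by blast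
  next
    case True
    then have \<nu>0: "emeasure \<nu> A = 0" for A
      using assms(3) emeasure_space[of \<nu> A] M1_D(3)[OF assms(2)] by simp
    have "AE x in \<mu>. P x" for P
      using True M1_D(1,3)[OF assms(1)] by (intro AE_I[of _ _ UNIV]) auto
    then have "(\<lambda>x. null_measure borel) \<in> moment_preserving_kernels \<mu> \<nu>"
      by (auto simp: moment_preserving_kernels_def transport_kernels_def unnormalized_kernel_def \<nu>0
          intro!: finite_measureI)
    then show ?thesis by blast
  qed
next
  assume "moment_preserving_kernels \<mu> \<nu> \<noteq> {}"
  then show "\<mu> \<preceq>\<^sub>s \<nu>"
    using support_le_of_moment_preserving_kernel[OF assms(1,2)] by blast
qed

end
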